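(* Let $r\ge 2$ and $n\ge 2r$ be integers, and let $P=\{\gamma_{2r-1}(1),\gamma_{2r-1}(2),\dots,\gamma_{2r-1}(n)\}\subset\mathbb{R}^{2r-1}$. Then $$b_{2r-1}(P)=(n-2r+2)\binom{n-r}{r-1}=\tau_{2r-1}(P).$$
   Context: The moment curve in $\mathbb{R}^d$ is parametrized by $\gamma_d(t)=(t,t^2,\dots,t^d)$. A finite set $P\subset\mathbb{R}^d$ is in general position if every subset of at most $d+1$ points is affinely independent (sets of distinct points on the moment curve satisfy this). For $P\subset\mathbb{R}^d$ in general position, $b_d(P)$ is the minimum of $|Q|$ over all sets $Q\subset\mathbb{R}^d\setminus P$ such that $Q\cap\operatorname{relint}\operatorname{conv}(A)\ne\emptyset$ for every $d$-element subset $A\subseteq P$. For a triangulation $T$ of $\operatorname{conv}(P)$ with vertex set equal to $P$ (a geometric simplicial complex with vertex set $P$ whose union is $\operatorname{conv}(P)$), $f_{d-1}(T)$ denotes the number of $(d-1)$-dimensional faces of $T$, and $\tau_d(P)=\max_T f_{d-1}(T)$, the maximum over all such triangulations $T$. *)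

theory Defs
  imports "HOL-Analysis.Analysis"
begin

text \<open>
  The coordinates of \<open>real ^ 'd\<close> are numbered \<open>1, \<dots>, CARD('d)\<close> along the linear order of the
  index type: \<open>card {j. j \<le> i}\<close> is the position of \<open>i\<close>.
\<close>

definition moment_curve :: "real \<Rightarrow> real ^ 'd::{finite, linorder}" where
  "moment_curve t = (\<chi> i. t ^ card {j. j \<le> i})"

definition blocks :: "'a::euclidean_space set \<Rightarrow> 'a set \<Rightarrow> bool" where
  "blocks Q P \<longleftrightarrow> Q \<inter> P = {} \<and>
     (\<forall>A. A \<subseteq> P \<and> card A = DIM('a) \<longrightarrow> Q \<inter> rel_interior (convex hull A) \<noteq> {})"

text \<open>Infinite sets \<open>Q\<close> are excluded explicitly, since \<open>card\<close> sends them to \<open>0\<close>.\<close>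

definition blocking_number :: "'a::euclidean_space set \<Rightarrow> nat" where
  "blocking_number P = (LEAST k. \<exists>Q. finite Q \<and> card Q = k \<and> blocks Q P)"

text \<open>
  The library's \<open>triangulation\<close> is not required to be closed under faces, so we use
  \<open>simplicial_complex\<close>; its members include the empty face.
\<close>

definition triangulates :: "'a::euclidean_space set set \<Rightarrow> 'a set \<Rightarrow> bool" where
  "triangulates T P \<longleftrightarrow> simplicial_complex T \<and> {v. {v} \<in> T} = P \<and> \<Union>T = convex hull P"

definition face_count :: "int \<Rightarrow> 'a::euclidean_space set set \<Rightarrow> nat" where
  "face_count k T = card {F \<in> T. k simplex F}"

definition max_codim1_faces :: "'a::euclidean_space set \<Rightarrow> nat" where
  "max_codim1_faces P = Max {face_count (int DIM('a) - 1) T | T. triangulates T P}"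

end

theory Submission
  imports Defs
begin

text \<open>
  Distinct codimension-one faces of a triangulation have disjoint relative interiors, so a blocking
  set has at least as many points as any triangulation has such faces; it remains to find a blocking
  set and a triangulation that both attain the stated number.

  For parameters \<open>a\<^sub>1 < b\<^sub>1 < a\<^sub>2 < \<dots> < b\<^bsub>r-1\<^esub> < a\<^sub>r\<close>, the divided difference over all of them has positive
  coefficients at the \<open>a\<^sub>i\<close> and negative ones at the \<open>b\<^sub>i\<close>, and as a functional on polynomials of degree at
  most \<open>2r - 1\<close> it depends only on the sum of the parameters. Hence the barycentre of the points \<open>b\<^sub>i\<close>, moved a
  little in the corresponding direction, lies in the relative interior of every simplex with the same
  \<open>b\<^sub>i\<close> and the same parameter sum. There are \<open>(n - r) choose (r - 1)\<close> choices of the \<open>b\<^sub>i\<close>, and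
  \<open>n - 2r + 2\<close> sums for each of them.

  The triangulation is the projection of the lower envelope of the points lifted by \<open>t\<^bsup>2r\<^esup>\<close>. Its faces are
  the parameter sets that do not contain \<open>r + 1\<close> pairwise non-adjacent elements: an affine relation on
  the moment curve has at least \<open>2r\<close> sign changes, so one of its two sign classes contains such elements.
\<close>

section \<open>Divided differences and sign changes\<close>

lemma lift_less_upto:
  fixes s :: "nat \<Rightarrow> nat"
  assumes "\<And>i. i < m \<Longrightarrow> s i < s (Suc i)" "i < j" "j \<le> m"
  shows "s i < s j"
  using assms(2,3)
proof (induction j)
  case (Suc j)
  then show ?case
    using assms(1)[of j] by (cases "i = j") auto
qed simp

text \<open>The Lagrange form of the divided difference: for a nonempty finite \<open>A\<close>, the
  coefficient of degree \<open>card A - 1\<close> of the polynomial interpolating \<open>f\<close>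
  on \<open>A\<close>. It exhibits the coefficient of each node, and hence its sign.\<close>

definition divided_difference :: "real set \<Rightarrow> (real \<Rightarrow> real) \<Rightarrow> real" where
  "divided_difference A f = (\<Sum>a\<in>A. f a / (\<Prod>b\<in>A - {a}. a - b))"

text \<open>The factor \<open>x - c\<close> kills the new node and cancels the factor
  \<open>a - c\<close> in every other denominator.\<close>

lemma divided_difference_insert:
  assumes "finite A" "c \<notin> A"
  shows "divided_difference (insert c A) (\<lambda>x. (x - c) * f x) = divided_difference A f"
proof -
  have "(a - c) * f a / (\<Prod>b\<in>insert c A - {a}. a - b) = f a / (\<Prod>b\<in>A - {a}. a - b)"
    if "a \<in> A" for a
  proof -
    have "insert c A - {a} = insert c (A - {a})"
      using assms that by auto
    then show ?thesis
      using assms that by auto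
  qed
  then show ?thesis
    using assms by (simp add: divided_difference_def)
qed

text \<open>Split \<open>x ^ Suc k\<close> as \<open>(x - c) * x ^ k + c * x ^ k\<close>. The
  resulting recursion drives the evaluations on monomials.\<close>

lemma divided_difference_insert_power:
  assumes "finite A" "c \<notin> A"
  shows "divided_difference (insert c A) (\<lambda>x. x ^ Suc k) =
    c * divided_difference (insert c A) (\<lambda>x. x ^ k) + divided_difference A (\<lambda>x. x ^ k)"
proof -
  have "divided_difference (insert c A) (\<lambda>x. (x - c) * x ^ k) =
      divided_difference (insert c A) (\<lambda>x. x ^ Suc k) - c * divided_difference (insert c A) (\<lambda>x. x ^ k)"
    by (simp add: divided_difference_def algebra_simps diff_divide_distrib sum_subtractf sum_distrib_left)
  then show ?thesis
    using divided_difference_insert[OF assms] by simp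
qed

lemma divided_difference_linear:
  "divided_difference A (\<lambda>x. (f x - g x) / e) = (divided_difference A f - divided_difference A g) / e"
  by (simp add: divided_difference_def diff_divide_distrib sum_subtractf sum_divide_distrib mult.commute)

text \<open>For distinct nodes \<open>c\<close> and \<open>d\<close> the constant 1 is
  \<open>((x - c) - (x - d)) / (d - c)\<close>. Each factor removes one node, and by induction the
  two smaller sets give equal values, which cancel.\<close>

lemma divided_difference_one:
  assumes "card A = Suc m"
  shows "divided_difference A (\<lambda>x. 1) = (if m = 0 then 1 else 0)"
  using assms
proof (induction m arbitrary: A)
  case 0
  then obtain a where "A = {a}"
    by (metis One_nat_def card_1_singletonE)
  then show ?case
    by (simp add: divided_difference_def)
next
  case (Suc m)
  then obtain c A' where A: "A = insert c A'" "c \<notin> A'" "card A' = Suc m" "finite A'"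
    by (metis card_Suc_eq card.infinite nat.simps(3))
  then obtain d B where B: "A' = insert d B" "d \<notin> B" "card B = m"
    by (metis card_Suc_eq)
  have fin: "finite (insert c B)"
    using A B by auto
  have "divided_difference A (\<lambda>x. 1) = divided_difference A (\<lambda>x. ((x - c) * 1 - (x - d) * 1) / (d - c))"
  proof -
    have "(\<lambda>x. 1) = (\<lambda>x. ((x - c) * 1 - (x - d) * 1) / (d - c))"
      using A B by (intro ext) simp
    then show ?thesis
      by (rule arg_cong)
  qed
  also have "\<dots> = (divided_difference A (\<lambda>x. (x - c) * 1) - divided_difference A (\<lambda>x. (x - d) * 1)) / (d - c)"
    by (rule divided_difference_linear)
  also have "divided_difference A (\<lambda>x. (x - c) * 1) = divided_difference A' (\<lambda>x. 1)"
    using divided_difference_insert[of A' c "\<lambda>x. 1"] A by simp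
  also have "divided_difference A (\<lambda>x. (x - d) * 1) = divided_difference (insert c B) (\<lambda>x. 1)"
    using divided_difference_insert[of "insert c B" d "\<lambda>x. 1"] A B fin
    by (simp add: insert_commute)
  also have "card (insert c B) = Suc m"
    using A B fin by auto
  ultimately show ?case
    using Suc.IH[of A'] Suc.IH[of "insert c B"] A by simp
qed

lemma divided_difference_power_less:
  assumes "card A = Suc m" "k < m"
  shows "divided_difference A (\<lambda>x. x ^ k) = 0"
  using assms
proof (induction k arbitrary: A m)
  case 0
  then show ?case
    using divided_difference_one[of A m] by simp
next
  case (Suc k)
  then obtain c A' m' where A: "A = insert c A'" "c \<notin> A'" "card A' = Suc m'" "m = Suc m'" "finite A'"
    by (metis card_Suc_eq card.infinite nat.simps(3) Suc_lessE)
  show ?case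
    using Suc.IH[of A m] Suc.IH[of A' m'] Suc.prems A
    unfolding A(1) by (subst divided_difference_insert_power) auto
qed

lemma divided_difference_power_eq:
  assumes "card A = Suc m"
  shows "divided_difference A (\<lambda>x. x ^ m) = 1"
  using assms
proof (induction m arbitrary: A)
  case 0
  then show ?case
    using divided_difference_one[of A 0] by simp
next
  case (Suc m)
  then obtain c A' where A: "A = insert c A'" "c \<notin> A'" "card A' = Suc m" "finite A'"
    by (metis card_Suc_eq card.infinite nat.simps(3))
  show ?case
    using Suc.IH[of A'] divided_difference_power_less[OF Suc.prems, of m] A
    unfolding A(1) by (subst divided_difference_insert_power) auto
qed

text \<open>On \<open>x ^ (m + j)\<close> the value is the complete homogeneous symmetric polynomial
  of degree \<open>j\<close> in the nodes; here \<open>j = 1\<close>. This is why a blocking point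
  depends on the parameter sum.\<close>

lemma divided_difference_power_Suc:
  assumes "card A = Suc m"
  shows "divided_difference A (\<lambda>x. x ^ Suc m) = \<Sum>A"
  using assms
proof (induction m arbitrary: A)
  case 0
  then obtain a where "A = {a}"
    by (metis One_nat_def card_1_singletonE)
  then show ?case
    by (simp add: divided_difference_def)
next
  case (Suc m)
  then obtain c A' where A: "A = insert c A'" "c \<notin> A'" "card A' = Suc m" "finite A'"
    by (metis card_Suc_eq card.infinite nat.simps(3))
  show ?case
    using Suc.IH[of A'] divided_difference_power_eq[OF Suc.prems] A
    unfolding A(1) by (subst divided_difference_insert_power) auto
qed

text \<open>Only the nodes above \<open>a\<close> give negative factors. Hence the coefficients of a
  divided difference alternate along the nodes.\<close>

lemma prod_diff_sign:
  fixes A :: "real set"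
  assumes "finite A"
  shows "0 < (- 1) ^ card {b \<in> A. a < b} * (\<Prod>b\<in>A - {a}. a - b)"
proof -
  have "A - {a} = {b \<in> A. b < a} \<union> {b \<in> A. a < b}"
    by auto
  then have "(\<Prod>b\<in>A - {a}. a - b) = (\<Prod>b\<in>{b \<in> A. b < a}. a - b) * (\<Prod>b\<in>{b \<in> A. a < b}. a - b)"
    using assms by (simp add: prod.union_disjoint disjoint_iff)
  also have "(\<Prod>b\<in>{b \<in> A. a < b}. a - b) = (\<Prod>b\<in>{b \<in> A. a < b}. (- 1) * (b - a))"
    by (intro prod.cong) auto
  also have "\<dots> = (- 1) ^ card {b \<in> A. a < b} * (\<Prod>b\<in>{b \<in> A. a < b}. b - a)"
    by (simp only: prod.distrib prod_constant)
  finally have "(- 1) ^ card {b \<in> A. a < b} * (\<Prod>b\<in>A - {a}. a - b) =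
      ((- 1) ^ card {b \<in> A. a < b} * (- 1) ^ card {b \<in> A. a < b}) *
      ((\<Prod>b\<in>{b \<in> A. b < a}. a - b) * (\<Prod>b\<in>{b \<in> A. a < b}. b - a))"
    by simp
  also have "\<dots> = (\<Prod>b\<in>{b \<in> A. b < a}. a - b) * (\<Prod>b\<in>{b \<in> A. a < b}. b - a)"
    by (simp flip: power_add)
  also have "\<dots> > 0"
    by (intro mult_pos_pos prod_pos) auto
  finally show ?thesis .
qed

text \<open>
  The discrete form of Descartes' rule of signs. The induction multiplies \<open>\<delta>\<close> by a linear factor
  that vanishes at the first sign change, which trades one vanishing moment for one sign change.
\<close>

lemma vanishing_moments_imp_sign_changes:
  fixes \<delta> :: "nat \<Rightarrow> real"
  assumes "finite X" "\<And>k. k < m \<Longrightarrow> (\<Sum>t\<in>X. \<delta> t * real t ^ k) = 0" "\<exists>t\<in>X. \<delta> t \<noteq> 0"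
  shows "\<exists>s. (\<forall>i<m. s i < s (Suc i) \<and> \<delta> (s i) * \<delta> (s (Suc i)) < 0) \<and> s ` {..m} \<subseteq> X \<and> \<delta> (s 0) \<noteq> 0"
  using assms(2,3)
proof (induction m arbitrary: \<delta>)
  case 0
  then obtain t where "t \<in> X" "\<delta> t \<noteq> 0"
    by auto
  then show ?case
    by (intro exI[of _ "\<lambda>_. t"]) auto
next
  case (Suc m)
  define t0 where "t0 = (LEAST t. t \<in> X \<and> \<delta> t \<noteq> 0)"
  have t0: "t0 \<in> X" "\<delta> t0 \<noteq> 0"
    using LeastI_ex[of "\<lambda>t. t \<in> X \<and> \<delta> t \<noteq> 0"] Suc.prems(2) unfolding t0_def by auto
  have t0_le: "t0 \<le> t" if "t \<in> X" "\<delta> t \<noteq> 0" for t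
    unfolding t0_def using that by (intro Least_le) auto
  \<comment> \<open>The zeroth moment vanishes, so the nonzero values of \<open>\<delta>\<close>
    cannot all share one sign.\<close>
  have ex: "\<exists>t. t \<in> X \<and> \<delta> t * \<delta> t0 < 0"
  proof (rule ccontr)
    assume "\<not> ?thesis"
    then have nn: "\<And>t. t \<in> X \<Longrightarrow> \<delta> t * \<delta> t0 \<ge> 0"
      by force
    have "(\<Sum>t\<in>X. \<delta> t * \<delta> t0) = 0"
      using Suc.prems(1)[of 0] by (simp flip: sum_distrib_right)
    then have "\<delta> t0 * \<delta> t0 = 0"
      using nn t0(1) \<open>finite X\<close> by (subst (asm) sum_nonneg_eq_0_iff) auto
    then show False
      using t0 by simp
  qed
  define z where "z = (LEAST t. t \<in> X \<and> \<delta> t * \<delta> t0 < 0)"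
  have z: "z \<in> X" "\<delta> z * \<delta> t0 < 0"
    using LeastI_ex[OF ex] unfolding z_def by auto
  have z_le: "z \<le> t" if "t \<in> X" "\<delta> t * \<delta> t0 < 0" for t
    unfolding z_def using that by (intro Least_le) auto
  have "t0 < z"
  proof -
    have "t0 \<noteq> z"
      using z t0 by (metis not_square_less_zero)
    moreover have "t0 \<le> z"
      using z by (intro t0_le) auto
    ultimately show ?thesis by simp
  qed
  \<comment> \<open>The root lies halfway between \<open>z - 1\<close> and \<open>z\<close>, so no
    parameter is a root: signs before \<open>z\<close> flip and signs from \<open>z\<close> on stay.
    Afterwards no parameter up to \<open>z\<close> carries the sign of
    \<open>\<delta> t0\<close>.\<close>
  define \<delta>' where "\<delta>' t = (real t - (real z - 1/2)) * \<delta> t" for t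
  have big: "z < t" "\<delta> t * \<delta> t0 > 0" if "t \<in> X" "\<delta>' t * \<delta> t0 > 0" for t
  proof -
    show "z < t"
    proof (rule ccontr)
      assume "\<not> z < t"
      then consider "t < z" | "t = z" by linarith
      then show False
      proof cases
        case 1
        then have "\<delta> t * \<delta> t0 \<ge> 0"
          using z_le[of t] that by force
        moreover have "real t - (real z - 1/2) < 0"
          using 1 by simp
        ultimately show False
          using that(2) unfolding \<delta>'_def mult.assoc by (simp add: zero_less_mult_iff)
      next
        case 2
        then show False
          using that(2) z unfolding \<delta>'_def mult.assoc by (auto simp: zero_less_mult_iff mult_less_0_iff)
      qed
    qed
    then have "real t - (real z - 1/2) > 0"
      by simp
    then show "\<delta> t * \<delta> t0 > 0"
      using that(2) unfolding \<delta>'_def mult.assoc by (simp add: zero_less_mult_iff)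
  qed
  have after: "\<delta>' t * \<delta>' u < 0 \<longleftrightarrow> \<delta> t * \<delta> u < 0" if "z < t" "z < u" for t u
  proof -
    have "\<delta>' t * \<delta>' u = ((real t - (real z - 1/2)) * (real u - (real z - 1/2))) * (\<delta> t * \<delta> u)"
      by (simp add: \<delta>'_def)
    moreover have "(real t - (real z - 1/2)) * (real u - (real z - 1/2)) > 0"
      using that by simp
    moreover have "c > 0 \<Longrightarrow> c * y < 0 \<longleftrightarrow> y < 0" for c y :: real
      by (simp add: mult_less_0_iff)
    ultimately show ?thesis
      by metis
  qed
  have mom: "(\<Sum>t\<in>X. \<delta>' t * real t ^ k) = 0" if "k < m" for k
  proof -
    have "(\<Sum>t\<in>X. \<delta>' t * real t ^ k) =
        (\<Sum>t\<in>X. \<delta> t * real t ^ Suc k) - (real z - 1/2) * (\<Sum>t\<in>X. \<delta> t * real t ^ k)"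
      by (simp add: \<delta>'_def algebra_simps sum_subtractf sum_distrib_left sum.distrib)
    then show ?thesis
      using Suc.prems(1)[of k] Suc.prems(1)[of "Suc k"] that by simp
  qed
  have "\<delta>' z \<noteq> 0"
    using z by (auto simp: \<delta>'_def)
  then have "\<exists>t\<in>X. \<delta>' t \<noteq> 0"
    using z(1) by blast
  from Suc.IH[of \<delta>', OF mom this] obtain s where s: "\<And>i. i < m \<Longrightarrow> s i < s (Suc i)" "\<And>i. i < m \<Longrightarrow> \<delta>' (s i) * \<delta>' (s (Suc i)) < 0"
    "s ` {..m} \<subseteq> X" "\<delta>' (s 0) \<noteq> 0"
    by blast
  \<comment> \<open>If \<open>s\<close> starts with the wrong sign, its first entry is dropped. The
    \<open>m\<close> entries kept start with the sign of \<open>\<delta> t0\<close>, hence lie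
    beyond \<open>z\<close>, where \<open>\<delta>\<close> and \<open>\<delta>'\<close> have the
    same signs.\<close>
  obtain p where p: "\<And>i. Suc i < m \<Longrightarrow> p i < p (Suc i)" "\<And>i. Suc i < m \<Longrightarrow> \<delta>' (p i) * \<delta>' (p (Suc i)) < 0"
    "p ` {..<m} \<subseteq> X" "m > 0 \<Longrightarrow> \<delta>' (p 0) * \<delta> t0 > 0"
  proof (cases "\<delta>' (s 0) * \<delta> t0 > 0")
    case True
    then show ?thesis
      using that[of s] s by force
  next
    case False
    then have neg: "\<delta>' (s 0) * \<delta> t0 < 0"
      using s(4) t0(2) by (metis linorder_cases mult_eq_0_iff)
    have "\<delta>' (s (Suc 0)) * \<delta> t0 > 0" if "m > 0"
      using neg s(2)[OF that] by (auto simp: mult_less_0_iff zero_less_mult_iff)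
    then show ?thesis
      using that[of "\<lambda>i. s (Suc i)"] s by (auto simp: image_subset_iff)
  qed
  have p_big: "z < p i" if "i < m" for i
  proof -
    have pz: "z < p 0"
      using big(1)[of "p 0"] p(3) p(4) that by (auto simp: image_subset_iff)
    show ?thesis
    proof (cases "i = 0")
      case False
      have "p 0 < p i"
        by (rule lift_less_upto[of "m - 1"]) (use p(1) that False in auto)
      then show ?thesis
        using pz by simp
    qed (use pz in simp)
  qed
  have p0: "\<delta> z * \<delta> (p 0) < 0" if "m > 0"
  proof -
    have "\<delta> (p 0) * \<delta> t0 > 0"
      using big(2)[of "p 0"] p(3) p(4) that by (auto simp: image_subset_iff)
    then show ?thesis
      using z by (auto simp: mult_less_0_iff zero_less_mult_iff)
  qed
  \<comment> \<open>Putting \<open>t0\<close> and \<open>z\<close> in front of the \<open>m\<close>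
    entries of \<open>p\<close> gives the \<open>m + 2\<close> entries required.\<close>
  define q where "q = case_nat t0 (case_nat z p)"
  have "q i < q (Suc i) \<and> \<delta> (q i) * \<delta> (q (Suc i)) < 0" if "i < Suc m" for i
  proof -
    consider "i = 0" | "i = 1" | j where "i = Suc (Suc j)"
      by (metis One_nat_def old.nat.exhaust)
    then show ?thesis
    proof cases
      case 1
      then show ?thesis
        using \<open>t0 < z\<close> z by (simp add: q_def mult.commute)
    next
      case 2
      then show ?thesis
        using p0 p_big[of 0] that by (simp add: q_def)
    next
      case 3
      then show ?thesis
        using p(1,2)[of j] after[of "p j" "p (Suc j)"] p_big[of j] p_big[of "Suc j"] that
        by (simp add: q_def)
    qed
  qed
  moreover have "q ` {..Suc m} \<subseteq> X"
    using t0 z p(3) by (auto simp: q_def image_subset_iff split: nat.split)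
  moreover have "\<delta> (q 0) \<noteq> 0"
    using t0 by (simp add: q_def)
  ultimately show ?case
    by blast
qed

section \<open>Counting parameter sets\<close>

definition gapped :: "nat set \<Rightarrow> bool" where
  "gapped S \<longleftrightarrow> (\<forall>i\<in>S. Suc i \<notin> S)"

lemma gapped_subset: "gapped S \<Longrightarrow> G \<subseteq> S \<Longrightarrow> gapped G"
  by (auto simp: gapped_def)

text \<open>These are the independent sets of a path. Either the last vertex is absent, or it is
  present and its neighbour is absent, which yields Pascal's rule.\<close>

lemma card_gapped_subsets_lessThan:
  "card {B. B \<subseteq> {..<m} \<and> card B = k \<and> gapped B} = (Suc m - k) choose k"
proof (induction m arbitrary: k rule: less_induct)
  case (less m)
  show ?case
  proof (cases k)
    case 0
    have "{B. B \<subseteq> {..<m} \<and> card B = k \<and> gapped B} = {{}}"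
      using 0 by (auto simp: gapped_def dest: finite_subset)
    then show ?thesis
      using 0 by simp
  next
    case (Suc k')
    consider "m = 0" | "m = 1" | m' where "m = Suc (Suc m')"
      by (metis One_nat_def old.nat.exhaust)
    then show ?thesis
    proof cases
      case 1
      then have "{B. B \<subseteq> {..<m} \<and> card B = k \<and> gapped B} = {}"
        using Suc by auto
      then show ?thesis
        using 1 Suc by simp
    next
      case 2
      have "{B. B \<subseteq> {..<m} \<and> card B = k \<and> gapped B} = (if k = 1 then {{0}} else {})"
        using 2 Suc by (auto simp: gapped_def lessThan_Suc subset_singleton_iff)
      then show ?thesis
        using 2 Suc by (auto simp: not_le)
    next
      case 3
      define F where "F m k = {B. B \<subseteq> {..<m} \<and> card B = k \<and> gapped B}" for m k
      have fin: "finite (F m k)" for m k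
        unfolding F_def by (rule finite_subset[of _ "Pow {..<m}"]) auto
      have finB: "finite B" if "B \<in> F m k" for B m k
        using that by (auto simp: F_def intro: finite_subset)
      have eq: "F m k = F (Suc m') (Suc k') \<union> insert (Suc m') ` F m' k'" (is "?L = ?R")
      proof (intro equalityI subsetI)
        fix B assume B: "B \<in> ?L"
        show "B \<in> ?R"
        proof (cases "Suc m' \<in> B")
          case True
          have "m' \<notin> B"
            using B True by (auto simp: F_def gapped_def)
          then have "B - {Suc m'} \<subseteq> {..<m'}"
            using B 3 by (auto simp: F_def subset_iff less_Suc_eq)
          then have "B - {Suc m'} \<in> F m' k'"
            using B True Suc finB[OF B] by (auto simp: F_def gapped_def)
          moreover have "B = insert (Suc m') (B - {Suc m'})"
            using True by auto
          ultimately show ?thesis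
            by blast
        next
          case False
          then show ?thesis
            using B 3 Suc by (auto simp: F_def subset_iff less_Suc_eq)
        qed
      next
        fix B assume "B \<in> ?R"
        then show "B \<in> ?L"
        proof
          assume "B \<in> insert (Suc m') ` F m' k'"
          then obtain C where C: "B = insert (Suc m') C" "C \<in> F m' k'"
            by auto
          then have "Suc m' \<notin> C" "m' \<notin> C" "Suc (Suc m') \<notin> C"
            by (auto simp: F_def)
          then show ?thesis
            using C finB[OF C(2)] 3 Suc by (fastforce simp: F_def gapped_def)
        qed (use 3 Suc in \<open>auto simp: F_def\<close>)
      qed
      have inj: "inj_on (insert (Suc m')) (F m' k')"
      proof (rule inj_onI)
        fix C D assume "C \<in> F m' k'" "D \<in> F m' k'" "insert (Suc m') C = insert (Suc m') D"
        moreover from this have "Suc m' \<notin> C" "Suc m' \<notin> D"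
          by (auto simp: F_def)
        ultimately show "C = D"
          by (simp add: insert_ident)
      qed
      have "F (Suc m') (Suc k') \<inter> insert (Suc m') ` F m' k' = {}"
        by (auto simp: F_def)
      then have "card (F m k) = card (F (Suc m') (Suc k')) + card (F m' k')"
        unfolding eq using fin inj by (simp add: card_Un_disjoint card_image)
      also have "\<dots> = ((Suc (Suc m') - Suc k') choose Suc k') + ((Suc m' - k') choose k')"
        unfolding F_def using less.IH[of "Suc m'" "Suc k'"] less.IH[of m' k'] 3 by simp
      also have "\<dots> = (Suc m - k) choose k"
      \<comment> \<open>If \<open>k'\<close> exceeds \<open>Suc m'\<close>, truncated subtraction
        makes all three binomials zero; otherwise this is Pascal's rule.\<close>
      proof (cases "k' \<le> Suc m'")
        case True
        then have "Suc (Suc m') - k' = Suc (Suc m' - k')"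
          by simp
        then show ?thesis
          using 3 Suc by simp
      next
        case False
        then show ?thesis
          using 3 Suc by (simp add: not_le)
      qed
      finally show ?thesis
        unfolding F_def .
    qed
  qed
qed

text \<open>A shift by two reduces this to an initial segment. The parameters 1 and \<open>n\<close>
  are left out because an element in an even place of a set of odd size has elements of that set on
  both sides.\<close>

lemma card_gapped_subsets_interior:
  assumes "r \<ge> 1" "n \<ge> 2"
  shows "card {B. B \<subseteq> {2..<n} \<and> card B = r - 1 \<and> gapped B} = (n - r) choose (r - 1)"
proof -
  define f where "f = (`) (\<lambda>i. i + 2 :: nat)"
  have "bij_betw f {B. B \<subseteq> {..<n-2} \<and> card B = r - 1 \<and> gapped B}
    {B. B \<subseteq> {2..<n} \<and> card B = r - 1 \<and> gapped B}"
  proof (rule bij_betw_byWitness[of _ "(`) (\<lambda>i. i - 2)"])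
    show "\<forall>B\<in>{B. B \<subseteq> {..<n-2} \<and> card B = r - 1 \<and> gapped B}. (\<lambda>i. i - 2) ` f B = B"
      by (auto simp: f_def image_image)
    show "\<forall>B\<in>{B. B \<subseteq> {2..<n} \<and> card B = r - 1 \<and> gapped B}. f ((\<lambda>i. i - 2) ` B) = B"
    proof
      fix B assume "B \<in> {B. B \<subseteq> {2..<n} \<and> card B = r - 1 \<and> gapped B}"
      then have "(\<lambda>i. i - 2 + 2) ` B = (\<lambda>i. i) ` B"
        by (intro image_cong) (auto dest!: subsetD)
      then show "f ((\<lambda>i. i - 2) ` B) = B"
        by (simp add: f_def image_image)
    qed
    show "f ` {B. B \<subseteq> {..<n-2} \<and> card B = r - 1 \<and> gapped B} \<subseteq> {B. B \<subseteq> {2..<n} \<and> card B = r - 1 \<and> gapped B}"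
    proof clarify
      fix B :: "nat set" assume B: "B \<subseteq> {..<n-2}" "card B = r - 1" "gapped B"
      have "card (f B) = r - 1"
        using B(2) unfolding f_def by (subst card_image) (auto simp: inj_on_def)
      then show "f B \<subseteq> {2..<n} \<and> card (f B) = r - 1 \<and> gapped (f B)"
        using B(1,3) by (auto simp: f_def gapped_def)
    qed
    show "(`) (\<lambda>i. i - 2) ` {B. B \<subseteq> {2..<n} \<and> card B = r - 1 \<and> gapped B} \<subseteq>
        {B. B \<subseteq> {..<n-2} \<and> card B = r - 1 \<and> gapped B}"
    proof clarify
      fix B :: "nat set" assume B: "B \<subseteq> {2..<n}" "card B = r - 1" "gapped B"
      have "inj_on (\<lambda>i. i - 2) B"
        using B by (intro inj_on_diff_nat) auto
      moreover have "gapped ((\<lambda>i. i - 2) ` B)"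
        unfolding gapped_def
      proof clarify
        fix i j assume "i \<in> B" "j \<in> B" "Suc (i - 2) = j - 2"
        then have "j = Suc i"
          using B by force
        then show False
          using B \<open>i \<in> B\<close> \<open>j \<in> B\<close> by (auto simp: gapped_def)
      qed
      ultimately show "(\<lambda>i. i - 2) ` B \<subseteq> {..<n-2} \<and> card ((\<lambda>i. i - 2) ` B) = r - 1 \<and> gapped ((\<lambda>i. i - 2) ` B)"
        using B(1,2) by (auto simp: card_image less_diff_conv2 subset_iff)
    qed
  qed
  from bij_betw_same_card[OF this]
  have "card {B. B \<subseteq> {2..<n} \<and> card B = r - 1 \<and> gapped B} = (Suc (n - 2) - (r - 1)) choose (r - 1)"
    unfolding card_gapped_subsets_lessThan by (rule sym)
  also have "Suc (n - 2) - (r - 1) = n - r"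
    using assms by simp
  finally show ?thesis .
qed

section \<open>Elements in even places and the range of the parameter sum\<close>

definition even_places :: "nat set \<Rightarrow> nat set" where
  "even_places A = {a \<in> A. odd (card {a' \<in> A. a' < a})}"

lemma card_less_enumeration:
  fixes h :: "nat \<Rightarrow> 'a::linorder"
  assumes "strict_mono_on {..<m} h" "i < m"
  shows "card {a \<in> h ` {..<m}. a < h i} = i"
proof -
  have "{a \<in> h ` {..<m}. a < h i} = h ` {..<i}"
    using assms strict_mono_on_less[OF assms(1)] by auto
  moreover have "inj_on h {..<i}"
    using strict_mono_on_imp_inj_on[OF assms(1)] by (rule inj_on_subset) (use assms in auto)
  ultimately show ?thesis
    by (simp add: card_image)
qed

text \<open>Places count from 1 and the enumeration from 0, so even places are odd indices.\<close>

lemma even_places_enumeration: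
  assumes "strict_mono_on {..<Suc (2 * q)} h"
  shows "even_places (h ` {..<Suc (2 * q)}) = (\<lambda>j. h (Suc (2 * j))) ` {..<q}"
proof -
  have "even_places (h ` {..<Suc (2 * q)}) = h ` {i. i < Suc (2 * q) \<and> odd i}"
    using card_less_enumeration[OF assms] by (auto simp: even_places_def)
  also have "{i. i < Suc (2 * q) \<and> odd i} = (\<lambda>j. Suc (2 * j)) ` {..<q}"
    by (auto elim!: oddE)
  finally show ?thesis
    by (simp add: image_image)
qed

lemma sum_lessThan_double:
  fixes f :: "nat \<Rightarrow> 'a::comm_monoid_add"
  shows "(\<Sum>i<2 * q. f i) = (\<Sum>j<q. f (2 * j)) + (\<Sum>j<q. f (Suc (2 * j)))"
  by (induction q) (auto simp: algebra_simps)

text \<open>Each element in an even place exceeds its left neighbour and is below its right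
  neighbour by at least 1. Pairing with one side leaves an extreme element over, which is at least 1
  or at most \<open>n\<close>. The bounds leave \<open>n - 2 * q\<close> sums for given even
  places.\<close>

lemma even_places_sum_bounds:
  assumes "A \<subseteq> {1..n}" "card A = Suc (2 * q)"
  shows "even_places A \<subseteq> {2..<n}" "card (even_places A) = q" "gapped (even_places A)"
    "2 * \<Sum>(even_places A) + Suc q \<le> \<Sum>A" "\<Sum>A + q \<le> 2 * \<Sum>(even_places A) + n"
proof -
  have "finite A"
    using assms finite_subset by blast
  obtain h where h: "bij_betw h {..<Suc (2 * q)} A" "strict_mono_on {..<Suc (2 * q)} h"
    using ex_bij_betw_strict_mono_card[OF \<open>finite A\<close>] assms(2) by metis
  have A: "A = h ` {..<Suc (2 * q)}"
    using h by (simp add: bij_betw_def)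
  have mono: "h i < h j" if "i < j" "j < Suc (2 * q)" for i j
    using h(2) that by (auto simp: strict_mono_on_def)
  have inj: "inj_on h {..<Suc (2 * q)}"
    using h by (simp add: bij_betw_def)
  have rng: "1 \<le> h i" "h i \<le> n" if "i < Suc (2 * q)" for i
    using A assms(1) that by auto
  have B: "even_places A = (\<lambda>j. h (Suc (2 * j))) ` {..<q}"
    unfolding A by (rule even_places_enumeration[OF h(2)])
  have injB: "inj_on (\<lambda>j. h (Suc (2 * j))) {..<q}"
  proof (rule inj_onI)
    fix i j assume "i \<in> {..<q}" "j \<in> {..<q}" "h (Suc (2 * i)) = h (Suc (2 * j))"
    then show "i = j"
      using inj_onD[OF inj, of "Suc (2 * i)" "Suc (2 * j)"] by auto
  qed
  show "card (even_places A) = q"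
    unfolding B by (simp add: card_image injB)
  show "even_places A \<subseteq> {2..<n}"
  proof
    fix b assume "b \<in> even_places A"
    then obtain j where j: "j < q" "b = h (Suc (2 * j))"
      using B by auto
    then show "b \<in> {2..<n}"
      using mono[of "2 * j" "Suc (2 * j)"] mono[of "Suc (2 * j)" "Suc (Suc (2 * j))"]
        rng[of "2 * j"] rng[of "Suc (Suc (2 * j))"] by auto
  qed
  show "gapped (even_places A)"
    unfolding gapped_def
  proof (intro ballI notI)
    fix b assume "b \<in> even_places A" "Suc b \<in> even_places A"
    then obtain j j' where j: "j < q" "b = h (Suc (2 * j))" "j' < q" "Suc b = h (Suc (2 * j'))"
      using B by auto
    have "j < j'"
    proof (cases j j' rule: linorder_cases)
      case equal
      then show ?thesis
        using j(2,4) by simp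
    next
      case greater
      then have "h (Suc (2 * j')) < h (Suc (2 * j))"
        using j(1) by (intro mono) auto
      then show ?thesis
        using j(2,4) by simp
    qed
    then show False
      using mono[of "Suc (2 * j)" "Suc (Suc (2 * j))"] mono[of "Suc (Suc (2 * j))" "Suc (2 * j')"] j
      by auto
  qed
  have sB: "\<Sum>(even_places A) = (\<Sum>j<q. h (Suc (2 * j)))"
    unfolding B using injB by (simp add: sum.reindex)
  have sA: "\<Sum>A = (\<Sum>j<q. h (2 * j)) + (\<Sum>j<q. h (Suc (2 * j))) + h (2 * q)"
    unfolding A using inj by (simp add: sum.reindex sum_lessThan_double)
  \<comment> \<open>Both sides sum over the odd places, with the last or the first one split off.
    What remains are the left or the right neighbours of the even places.\<close>
  have shift: "(\<Sum>j<q. h (2 * j)) + h (2 * q) = h 0 + (\<Sum>j<q. h (2 * Suc j))"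
    using sum.lessThan_Suc[of "\<lambda>j. h (2 * j)" q] sum.lessThan_Suc_shift[of "\<lambda>j. h (2 * j)" q] by simp
  have "(\<Sum>j<q. h (Suc (2 * j)) + 1) \<le> (\<Sum>j<q. h (2 * Suc j))"
  proof (rule sum_mono)
    fix j assume "j \<in> {..<q}"
    then show "h (Suc (2 * j)) + 1 \<le> h (2 * Suc j)"
      using mono[of "Suc (2 * j)" "2 * Suc j"] by simp
  qed
  then have low: "(\<Sum>j<q. h (Suc (2 * j))) + q \<le> (\<Sum>j<q. h (2 * Suc j))"
    unfolding sum.distrib by simp
  have "(\<Sum>j<q. h (2 * j) + 1) \<le> (\<Sum>j<q. h (Suc (2 * j)))"
  proof (rule sum_mono)
    fix j assume "j \<in> {..<q}"
    then show "h (2 * j) + 1 \<le> h (Suc (2 * j))"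
      using mono[of "2 * j" "Suc (2 * j)"] by simp
  qed
  then have up: "(\<Sum>j<q. h (2 * j)) + q \<le> (\<Sum>j<q. h (Suc (2 * j)))"
    unfolding sum.distrib by simp
  show "2 * \<Sum>(even_places A) + Suc q \<le> \<Sum>A"
    using low shift rng[of 0] unfolding sA sB by linarith
  show "\<Sum>A + q \<le> 2 * \<Sum>(even_places A) + n"
    using up rng[of "2 * q"] unfolding sA sB by linarith
qed

section \<open>Narrow sets as unions of neighbouring pairs and a single element\<close>

definition narrow :: "nat \<Rightarrow> nat set \<Rightarrow> bool" where
  "narrow r S \<longleftrightarrow> (\<forall>G\<subseteq>S. gapped G \<longrightarrow> card G \<le> r)"

text \<open>This closure makes the narrow sets an abstract simplicial complex.\<close>

lemma narrow_subset: "narrow r S \<Longrightarrow> S' \<subseteq> S \<Longrightarrow> narrow r S'"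
  by (auto simp: narrow_def)

text \<open>
  A narrow set with \<open>2 * r - 1\<close> elements consists of \<open>r - 1\<close> pairs of neighbours and one single
  element \<open>x\<close>. We index it by \<open>x\<close> and the members of the pairs that are in even places.
\<close>

definition paired_set :: "nat set \<Rightarrow> nat \<Rightarrow> nat set" where
  "paired_set B x = insert x (B \<union> (\<lambda>b. if b < x then b - 1 else b + 1) ` B)"

text \<open>The partner \<open>p b\<close> lies on the side of \<open>b\<close> away from
  \<open>x\<close>. A run such as \<open>{b - 1, b, b + 1}\<close> could have either end as its
  single element; forbidding \<open>x\<close> to be the successor of an element of \<open>B\<close>
  leaves only the lower end.\<close>

context
  fixes B :: "nat set" and n q x :: nat and p A
  assumes B: "B \<subseteq> {2..<n}" "card B = q" "gapped B"
    and x: "x \<in> {1..n}" "x \<notin> B" "x \<notin> Suc ` B"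
  defines "p \<equiv> \<lambda>b. if b < x then b - 1 else b + 1"
  defines "A \<equiv> paired_set B x"
begin

private lemma fin: "finite B"
  using B finite_subset by blast

private lemma B_ge: "b \<in> B \<Longrightarrow> 2 \<le> b" "b \<in> B \<Longrightarrow> b < n"
  using B by auto

private lemma p_inj: "inj_on p B"
proof (rule inj_onI)
  fix b c assume bc: "b \<in> B" "c \<in> B" "p b = p c"
  then show "b = c"
    using B_ge(1)[OF bc(1)] B_ge(1)[OF bc(2)] by (auto simp: p_def split: if_splits)
qed

private lemma p_ne: "b \<in> B \<Longrightarrow> p b \<noteq> x"
  using B_ge[of b] x by (auto simp: p_def)

private lemma B_gap: "b \<in> B \<Longrightarrow> c \<in> B \<Longrightarrow> b < c \<Longrightarrow> Suc b < c"
  using B(3) by (metis Suc_lessI gapped_def)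

private lemma p_notin: "b \<in> B \<Longrightarrow> p b \<notin> B"
  using B_gap[of "p b" b] B_gap[of b "p b"] B_ge[of b] by (auto simp: p_def split: if_splits)

private lemma A_eq: "A = insert x (B \<union> p ` B)"
  by (simp add: A_def paired_set_def p_def)

lemma paired_set_subset: "paired_set B x \<subseteq> {1..n}"
proof -
  have "1 \<le> p b \<and> p b \<le> n" if "b \<in> B" for b
    using B_ge[OF that] by (auto simp: p_def)
  moreover have "1 \<le> b \<and> b \<le> n" if "b \<in> B" for b
    using B_ge[OF that] by auto
  ultimately show ?thesis
    using x unfolding A_eq[unfolded A_def] by auto
qed

text \<open>The set \<open>A\<close> is the disjoint union of \<open>{x}\<close>, \<open>B\<close>
  and the partners of \<open>B\<close>. The count is applied to the elements below a given one, to
  decide its place.\<close>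

private lemma card_part:
  "card {a \<in> A. Q a} = (if Q x then 1 else 0) + card {b \<in> B. Q b} + card {b \<in> B. Q (p b)}"
proof -
  have "{a \<in> A. Q a} = {a. a = x \<and> Q x} \<union> ({b \<in> B. Q b} \<union> p ` {b \<in> B. Q (p b)})"
    unfolding A_eq by auto
  also have "card \<dots> = card {a. a = x \<and> Q x} + card ({b \<in> B. Q b} \<union> p ` {b \<in> B. Q (p b)})"
    using fin x p_ne by (intro card_Un_disjoint) auto
  also have "card ({b \<in> B. Q b} \<union> p ` {b \<in> B. Q (p b)}) = card {b \<in> B. Q b} + card (p ` {b \<in> B. Q (p b)})"
    using fin p_notin by (intro card_Un_disjoint) auto
  also have "card (p ` {b \<in> B. Q (p b)}) = card {b \<in> B. Q (p b)}"
    using p_inj by (intro card_image) (auto simp: inj_on_def)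
  finally show ?thesis
    by auto
qed

lemma card_paired_set: "card (paired_set B x) = Suc (2 * q)"
  using card_part[of "\<lambda>_. True"] B unfolding A_def by simp

text \<open>A gapped set takes at most one element of each neighbouring pair, besides possibly
  \<open>x\<close>.\<close>

lemma narrow_paired_set: "narrow (Suc q) (paired_set B x)"
  unfolding narrow_def
proof (intro allI impI)
  fix G assume G: "G \<subseteq> paired_set B x" "gapped G"
  have "G \<subseteq> {x} \<union> (\<Union>b\<in>B. G \<inter> {b, p b})"
    using G A_eq unfolding A_def by auto
  then have "card G \<le> card ({x} \<union> (\<Union>b\<in>B. G \<inter> {b, p b}))"
    using fin by (intro card_mono) auto
  also have "\<dots> \<le> card {x} + card (\<Union>b\<in>B. G \<inter> {b, p b})"
    by (rule card_Un_le)
  also have "card (\<Union>b\<in>B. G \<inter> {b, p b}) \<le> (\<Sum>b\<in>B. card (G \<inter> {b, p b}))"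
    by (rule card_UN_le[OF fin])
  also have "\<dots> \<le> (\<Sum>b\<in>B. 1)"
  proof (rule sum_mono)
    fix b assume "b \<in> B"
    then have "p b = Suc b \<or> b = Suc (p b)"
      using B_ge[of b] by (auto simp: p_def)
    then have "b \<notin> G \<or> p b \<notin> G"
      using G(2) by (auto simp: gapped_def)
    then have "G \<inter> {b, p b} \<subseteq> {b} \<or> G \<inter> {b, p b} \<subseteq> {p b}"
      by auto
    then show "card (G \<inter> {b, p b}) \<le> 1"
      by (metis card.empty card_mono card_insert_disjoint finite.emptyI finite.insertI empty_iff One_nat_def)
  qed
  finally show "card G \<le> Suc q"
    using B by simp
qed

text \<open>Every other pair lies wholly on one side of the element considered, so it does not
  affect parity. Below \<open>b\<close> lies exactly one of \<open>p b\<close> and \<open>x\<close>;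
  below \<open>p b\<close> lie both or neither of \<open>b\<close> and \<open>x\<close>; below
  \<open>x\<close> there are only whole pairs.\<close>

lemma even_places_paired_set: "even_places (paired_set B x) = B"
proof -
  have in_B: "odd (card {a \<in> A. a < b})" if b: "b \<in> B" for b
  proof (cases "b < x")
    case True
    have "{c \<in> B. p c < b} = insert b {c \<in> B. c < b}"
      using b True B_ge B_gap x(2) by (force simp: p_def split: if_splits)
    then show ?thesis
      using True fin unfolding card_part by simp
  next
    case False
    have "{c \<in> B. p c < b} = {c \<in> B. c < b}"
      using b False B_ge B_gap x(2) by (force simp: p_def split: if_splits)
    moreover have "x < b"
      using False x b by (metis linorder_neqE_nat)
    ultimately show ?thesis
      using fin unfolding card_part by simp
  qed
  have at_x: "even (card {a \<in> A. a < x})"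
  proof -
    have "{c \<in> B. p c < x} = {c \<in> B. c < x}"
      using x B_ge by (force simp: p_def split: if_splits)
    then show ?thesis
      unfolding card_part by simp
  qed
  have at_p: "even (card {a \<in> A. a < p b})" if b: "b \<in> B" for b
  proof (cases "b < x")
    case True
    then have pb: "p b = b - 1"
      by (simp add: p_def)
    have "{c \<in> B. p c < b - 1} = {c \<in> B. c < b}"
      using b True B_ge B_gap[of _ b] B_gap[of b] x(2) by (force simp: p_def split: if_splits)
    moreover have "{c \<in> B. c < b - 1} = {c \<in> B. c < b}"
      using b B_gap[of _ b] by force
    ultimately show ?thesis
      using True fin unfolding card_part pb by simp
  next
    case False
    then have pb: "p b = b + 1"
      by (simp add: p_def)
    have "{c \<in> B. p c < b + 1} = {c \<in> B. c < b}"
      using b False B_ge B_gap[of _ b] B_gap[of b] x(2) by (force simp: p_def split: if_splits)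
    moreover have "{c \<in> B. c < b + 1} = insert b {c \<in> B. c < b}"
      using b by auto
    moreover have "x < b + 1"
      using False by auto
    ultimately show ?thesis
      using False fin unfolding card_part pb by simp
  qed
  show ?thesis
    unfolding even_places_def A_def[symmetric]
    using in_B at_x at_p A_eq by auto
qed

text \<open>A candidate other than \<open>x\<close> can only be a lower partner \<open>b - 1\<close>
  with \<open>b < x\<close>. Thus \<open>x\<close> can be recovered from \<open>B\<close> and the
  paired set as the largest candidate.\<close>

lemma single_maximal_in_paired_set:
  assumes "x' \<in> paired_set B x" "x' \<notin> B" "x' \<notin> Suc ` B"
  shows "x' \<le> x"
  using assms by (auto simp: paired_set_def split: if_splits)

end

text \<open>The set \<open>B\<close> and its successors occupy \<open>2 * (r - 1)\<close>
  parameters, which leaves \<open>n - 2 * r + 2\<close> values for \<open>x\<close>. Distinct pairs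
  \<open>(B, x)\<close> give distinct sets: the even places determine \<open>B\<close>, and
  maximality determines \<open>x\<close>.\<close>

lemma card_narrow_sets_ge:
  assumes "r \<ge> 1" "n \<ge> 2 * r"
  shows "(n - 2 * r + 2) * ((n - r) choose (r - 1)) \<le>
    card {A. A \<subseteq> {1..n} \<and> card A = 2 * r - 1 \<and> narrow r A}"
proof -
  define Bs where "Bs = {B. B \<subseteq> {2..<n} \<and> card B = r - 1 \<and> gapped B}"
  define X where "X B = {1..n} - (B \<union> Suc ` B)" for B :: "nat set"
  have card_X: "card (X B) = n - 2 * r + 2" if "B \<in> Bs" for B
  proof -
    have B: "B \<subseteq> {2..<n}" "card B = r - 1" "gapped B" "finite B"
      using that by (auto simp: Bs_def intro: finite_subset)
    have "card (B \<union> Suc ` B) = (r - 1) + (r - 1)"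
      using B by (subst card_Un_disjoint) (auto simp: gapped_def card_image)
    moreover have "B \<union> Suc ` B \<subseteq> {1..n}"
      using B(1) by force
    ultimately show ?thesis
      using assms B unfolding X_def by (subst card_Diff_subset) auto
  qed
  have finX: "finite (X B)" for B
    by (simp add: X_def)
  have "finite Bs"
    unfolding Bs_def by (rule finite_subset[of _ "Pow {2..<n}"]) auto
  have props: "paired_set B x \<subseteq> {1..n}" "card (paired_set B x) = 2 * r - 1" "narrow r (paired_set B x)"
    "even_places (paired_set B x) = B" if "B \<in> Bs" "x \<in> X B" for B x
  proof -
    have h: "B \<subseteq> {2..<n}" "card B = r - 1" "gapped B" "x \<in> {1..n}" "x \<notin> B" "x \<notin> Suc ` B"
      using that by (auto simp: Bs_def X_def)
    show "paired_set B x \<subseteq> {1..n}" "card (paired_set B x) = 2 * r - 1" "narrow r (paired_set B x)"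
      "even_places (paired_set B x) = B"
      using paired_set_subset[OF h] card_paired_set[OF h] narrow_paired_set[OF h] even_places_paired_set[OF h]
        assms by (auto simp: algebra_simps)
  qed
  have "inj_on (\<lambda>(B, x). paired_set B x) (Sigma Bs X)"
  proof (rule inj_onI, clarify)
    fix B x B' x'
    assume h: "B \<in> Bs" "x \<in> X B" "B' \<in> Bs" "x' \<in> X B'" "paired_set B x = paired_set B' x'"
    then have BB: "B = B'"
      using props(4) by metis
    have "x' \<in> paired_set B x" "x \<in> paired_set B' x'"
      using h(5) by (auto simp: paired_set_def)
    have "x' \<le> x"
      by (rule single_maximal_in_paired_set[of B n "r - 1" x x'])
        (use h(1-4) \<open>x' \<in> paired_set B x\<close> BB in \<open>auto simp: Bs_def X_def\<close>)
    moreover have "x \<le> x'"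
      by (rule single_maximal_in_paired_set[of B' n "r - 1" x' x])
        (use h(1-4) \<open>x \<in> paired_set B' x'\<close> BB in \<open>auto simp: Bs_def X_def\<close>)
    ultimately have "x = x'"
      by simp
    then show "B = B' \<and> x = x'"
      using BB by simp
  qed
  then have "card (Sigma Bs X) = card ((\<lambda>(B, x). paired_set B x) ` Sigma Bs X)"
    by (simp add: card_image)
  also have "\<dots> \<le> card {A. A \<subseteq> {1..n} \<and> card A = 2 * r - 1 \<and> narrow r A}"
  proof (rule card_mono)
    show "finite {A. A \<subseteq> {1..n} \<and> card A = 2 * r - 1 \<and> narrow r A}"
      by (rule finite_subset[of _ "Pow {1..n}"]) auto
    show "(\<lambda>(B, x). paired_set B x) ` Sigma Bs X \<subseteq> {A. A \<subseteq> {1..n} \<and> card A = 2 * r - 1 \<and> narrow r A}"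
      using props by fastforce
  qed
  also have "card (Sigma Bs X) = (\<Sum>B\<in>Bs. n - 2 * r + 2)"
    using \<open>finite Bs\<close> finX card_X by simp
  also have "\<dots> = (n - 2 * r + 2) * ((n - r) choose (r - 1))"
    using card_gapped_subsets_interior[of r n] assms by (simp add: Bs_def)
  finally show ?thesis .
qed

text \<open>The pairs are the labels of the blocking points. The interval \<open>R B\<close> of sums
  possible for a given \<open>B\<close> has \<open>n - 2 * r + 2\<close> elements.\<close>

lemma card_even_places_sum_le:
  assumes "r \<ge> 1" "n \<ge> 2 * r"
  shows "card ((\<lambda>A. (even_places A, \<Sum>A)) ` {A. A \<subseteq> {1..n} \<and> card A = 2 * r - 1}) \<le>
    (n - 2 * r + 2) * ((n - r) choose (r - 1))"
proof -
  define Bs where "Bs = {B. B \<subseteq> {2..<n} \<and> card B = r - 1 \<and> gapped B}"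
  define R where "R B = {2 * \<Sum>B + r..2 * \<Sum>B + n - (r - 1)}" for B :: "nat set"
  have "finite Bs"
    unfolding Bs_def by (rule finite_subset[of _ "Pow {2..<n}"]) auto
  have "(\<lambda>A. (even_places A, \<Sum>A)) ` {A. A \<subseteq> {1..n} \<and> card A = 2 * r - 1} \<subseteq> Sigma Bs R"
  proof clarify
    fix A assume A: "A \<subseteq> {1..n}" "card A = 2 * r - 1"
    have "card A = Suc (2 * (r - 1))"
      using A assms by simp
    from even_places_sum_bounds[OF A(1) this]
    show "even_places A \<in> Bs \<and> \<Sum>A \<in> R (even_places A)"
      using assms by (auto simp: Bs_def R_def)
  qed
  then have "card ((\<lambda>A. (even_places A, \<Sum>A)) ` {A. A \<subseteq> {1..n} \<and> card A = 2 * r - 1}) \<le> card (Sigma Bs R)"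
    using \<open>finite Bs\<close> by (intro card_mono) (auto simp: R_def)
  also have "\<dots> = (\<Sum>B\<in>Bs. card (R B))"
    using \<open>finite Bs\<close> by (simp add: R_def)
  also have "\<dots> = (\<Sum>B\<in>Bs. n - 2 * r + 2)"
    using assms by (intro sum.cong) (auto simp: R_def)
  also have "\<dots> = (n - 2 * r + 2) * ((n - r) choose (r - 1))"
    using card_gapped_subsets_interior[of r n] assms by (simp add: Bs_def)
  finally show ?thesis .
qed

section \<open>Points on the moment curve\<close>

lemma bij_betw_coordinate_position:
  "bij_betw (\<lambda>i::'d::{finite, linorder}. card {j. j \<le> i}) UNIV {1..CARD('d)}"
proof -
  have mono: "card {j. j \<le> i} < card {j. j \<le> k}" if "i < k" for i k :: 'd
    using that by (intro psubset_card_mono) (auto simp: psubset_eq set_eq_iff not_le intro: exI[of _ k])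
  have inj: "inj (\<lambda>i::'d. card {j. j \<le> i})"
    by (rule linorder_injI) (use mono in force)
  have "range (\<lambda>i::'d. card {j. j \<le> i}) \<subseteq> {1..CARD('d)}"
  proof clarify
    fix i :: 'd
    have "card {j. j \<le> i} > 0"
      by (auto simp: card_gt_0_iff)
    moreover have "card {j. j \<le> i} \<le> CARD('d)"
      by (intro card_mono) auto
    ultimately show "card {j. j \<le> i} \<in> {1..CARD('d)}"
      by auto
  qed
  then have "range (\<lambda>i::'d. card {j. j \<le> i}) = {1..CARD('d)}"
    using inj by (intro card_subset_eq) (auto simp: card_image)
  then show ?thesis
    using inj by (simp add: bij_betw_def)
qed

lemma coordinate_position_exists:
  assumes "k \<in> {1..CARD('d)}"
  shows "\<exists>i::'d::{finite, linorder}. card {j. j \<le> i} = k"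
proof -
  have "k \<in> range (\<lambda>i::'d. card {j. j \<le> i})"
    using bij_betw_coordinate_position[where 'd = 'd] assms by (simp add: bij_betw_def)
  then show ?thesis
    by auto
qed

section \<open>Affine combinations of moment points as power moments\<close>

abbreviation moment_point :: "nat \<Rightarrow> real ^ 'd::{finite, linorder}" where
  "moment_point t \<equiv> moment_curve (real t)"

lemma sum_moment_point_nth:
  "(\<Sum>t\<in>S. u t *\<^sub>R moment_point t) $ i = (\<Sum>t\<in>S. u t * real t ^ card {j. j \<le> i})"
  by (simp add: moment_curve_def)

text \<open>The coordinates supply the moments of exponents 1 to \<open>CARD('d)\<close>; the moment
  of exponent 0 comes from the sum of the weights.\<close>

lemma sum_moment_points_eqD:
  assumes "(\<Sum>t\<in>S. u t *\<^sub>R moment_point t) = (\<Sum>t\<in>S. v t *\<^sub>R (moment_point t :: real ^ 'd::{finite, linorder}))"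
    and "k \<in> {1..CARD('d)}"
  shows "(\<Sum>t\<in>S. u t * real t ^ k) = (\<Sum>t\<in>S. v t * real t ^ k)"
proof -
  obtain i :: 'd where i: "card {j. j \<le> i} = k"
    using coordinate_position_exists[OF assms(2)] by blast
  show ?thesis
    using arg_cong[OF assms(1), of "\<lambda>x. x $ i"] by (simp only: sum_moment_point_nth i)
qed

lemma sum_moment_points_eq_0:
  assumes "\<And>k. k \<in> {1..CARD('d)} \<Longrightarrow> (\<Sum>t\<in>S. u t * real t ^ k) = 0"
  shows "(\<Sum>t\<in>S. u t *\<^sub>R (moment_point t :: real ^ 'd::{finite, linorder})) = 0"
proof (subst vec_eq_iff, rule allI)
  fix i :: 'd
  have "card {j. j \<le> i} \<in> {1..CARD('d)}"
    using bij_betw_coordinate_position[where 'd = 'd] by (auto simp: bij_betw_def)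
  then show "(\<Sum>t\<in>S. u t *\<^sub>R (moment_point t :: (real, 'd) vec)) $ i = 0 $ i"
    using assms by (simp add: sum_moment_point_nth del: sum_component)
qed

lemma inj_moment_point: "inj_on (moment_point :: nat \<Rightarrow> real ^ 'd::{finite, linorder}) X"
proof (rule inj_onI)
  fix s t :: nat
  assume eq: "moment_point s = (moment_point t :: (real, 'd) vec)"
  obtain i :: 'd where i: "card {j. j \<le> i} = 1"
    using coordinate_position_exists[of 1, where 'd = 'd] by (auto simp: Suc_le_eq)
  have "moment_point s $ i = (moment_point t :: (real, 'd) vec) $ i"
    by (simp add: eq)
  then show "s = t"
    by (simp add: moment_curve_def i)
qed

text \<open>The witness is that \<open>(x - t)\<^sup>2\<close> vanishes on the curve only at the parameter \<open>t\<close>.\<close>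

lemma moment_point_combination:
  assumes "finite S" "\<And>s. s \<in> S \<Longrightarrow> 0 \<le> u s" "sum u S = 1"
    and eq: "(\<Sum>s\<in>S. u s *\<^sub>R moment_point s) = (moment_point t :: real ^ 'd::{finite, linorder})"
    and "CARD('d) \<ge> 2" "s \<in> S" "s \<noteq> t"
  shows "u s = 0"
proof -
  have pow: "(\<Sum>s\<in>S. u s * real s ^ k) = real t ^ k" if k: "k \<in> {1..CARD('d)}" for k
  proof -
    obtain i :: 'd where i: "card {j. j \<le> i} = k"
      using coordinate_position_exists[OF k] by blast
    have "(moment_point t :: (real, 'd) vec) $ i = real t ^ k"
      by (simp add: moment_curve_def i)
    then show ?thesis
      using arg_cong[OF eq, of "\<lambda>x. x $ i"] by (simp only: sum_moment_point_nth i)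
  qed
  have "(\<Sum>s\<in>S. u s * (real s - real t) ^ 2) =
      (\<Sum>s\<in>S. u s * real s ^ 2) - 2 * real t * (\<Sum>s\<in>S. u s * real s ^ 1) + (real t) ^ 2 * sum u S"
    by (simp add: power2_diff algebra_simps sum.distrib sum_subtractf sum_distrib_left sum_distrib_right)
  also have "\<dots> = 0"
    using pow[of 1] pow[of 2] assms(3,5) by (simp add: power2_eq_square)
  finally have "u s * (real s - real t) ^ 2 = 0"
    using assms(1,2,6) by (subst (asm) sum_nonneg_eq_0_iff) auto
  then show ?thesis
    using assms(7) by simp
qed

text \<open>Weights live on the common index set \<open>X\<close> and vanish off \<open>S\<close>,
  so that representations over different subsets can be subtracted.\<close>

lemma convex_hull_injective_image:
  fixes f :: "'b \<Rightarrow> 'a::real_vector"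
  assumes "finite X" "S \<subseteq> X" "inj_on f X"
  shows "x \<in> convex hull (f ` S) \<longleftrightarrow>
    (\<exists>u. (\<forall>t\<in>X. 0 \<le> u t) \<and> (\<forall>t\<in>X - S. u t = 0) \<and> sum u X = 1 \<and> (\<Sum>t\<in>X. u t *\<^sub>R f t) = x)"
    (is "?L \<longleftrightarrow> ?R")
proof -
  have inj: "inj_on f S" and fin: "finite S"
    using assms by (auto intro: inj_on_subset finite_subset)
  show ?thesis
  proof
    assume ?L
    then obtain w where w: "\<forall>x\<in>f ` S. 0 \<le> w x" "sum w (f ` S) = 1" "(\<Sum>x\<in>f ` S. w x *\<^sub>R x) = x"
      using convex_hull_finite[of "f ` S"] fin by auto
    define u where "u t = (if t \<in> S then w (f t) else 0)" for t
    have "sum u X = sum u S"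
      using assms by (intro sum.mono_neutral_right) (auto simp: u_def)
    also have "\<dots> = 1"
      using w(2) inj by (simp add: u_def sum.reindex)
    moreover have "(\<Sum>t\<in>X. u t *\<^sub>R f t) = (\<Sum>t\<in>S. u t *\<^sub>R f t)"
      using assms by (intro sum.mono_neutral_right) (auto simp: u_def)
    moreover have "(\<Sum>t\<in>S. u t *\<^sub>R f t) = x"
      using w(3) inj by (simp add: u_def sum.reindex)
    ultimately show ?R
      using w(1) by (intro exI[of _ u]) (auto simp: u_def)
  next
    assume ?R
    then obtain u where u: "\<forall>t\<in>X. 0 \<le> u t" "\<forall>t\<in>X - S. u t = 0" "sum u X = 1" "(\<Sum>t\<in>X. u t *\<^sub>R f t) = x"
      by auto
    have "sum u X = sum u S"
      by (rule sum.mono_neutral_right) (use assms u in auto)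
    moreover have "(\<Sum>t\<in>X. u t *\<^sub>R f t) = (\<Sum>t\<in>S. u t *\<^sub>R f t)"
      by (rule sum.mono_neutral_right) (use assms u in auto)
    ultimately show ?L
      using convex_sum[of S "convex hull (f ` S)" u f] fin u assms(2)
      by (auto intro: hull_inc)
  qed
qed

lemma positive_combination_in_rel_interior:
  fixes f :: "'b \<Rightarrow> 'a::euclidean_space"
  assumes "finite S" "inj_on f S" "\<And>t. t \<in> S \<Longrightarrow> 0 < u t" "sum u S = 1"
  shows "(\<Sum>t\<in>S. u t *\<^sub>R f t) \<in> rel_interior (convex hull (f ` S))"
proof -
  define w where "w x = u (the_inv_into S f x)" for x
  have w: "w (f t) = u t" if "t \<in> S" for t
    using that assms(2) by (simp add: w_def the_inv_into_f_f)
  have "(\<Sum>x\<in>f ` S. w x *\<^sub>R x) = (\<Sum>t\<in>S. u t *\<^sub>R f t)" "sum w (f ` S) = 1"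
    using assms w by (auto simp: sum.reindex)
  moreover have "\<forall>x\<in>f ` S. 0 < w x"
    using assms(3) w by simp
  ultimately show ?thesis
    using explicit_subset_rel_interior_convex_hull_minimal[of "f ` S"] assms(1) by blast
qed

text \<open>The relation kills the \<open>2 * r\<close> moments of exponents below
  \<open>2 * r\<close>, so it alternates along \<open>2 * r + 1\<close> parameters. Every second one
  has the sign of the first; these \<open>r + 1\<close> are kept apart by the others.\<close>

lemma affine_relation_imp_large_gapped_set:
  fixes \<delta> :: "nat \<Rightarrow> real"
  assumes "finite S" "CARD('d) = 2 * r - 1" "sum \<delta> S = 0"
    and "(\<Sum>t\<in>S. \<delta> t *\<^sub>R (moment_point t :: real ^ 'd::{finite, linorder})) = 0"
    and "\<exists>t\<in>S. \<delta> t \<noteq> 0"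
  shows "\<exists>G. card G = Suc r \<and> gapped G \<and> (G \<subseteq> {t \<in> S. \<delta> t > 0} \<or> G \<subseteq> {t \<in> S. \<delta> t < 0})"
proof -
  have "(\<Sum>t\<in>S. \<delta> t * real t ^ k) = 0" if "k < 2 * r" for k
  proof (cases "k = 0")
    case True
    then show ?thesis
      using assms(3) by simp
  next
    case False
    then have "k \<in> {1..CARD('d)}"
      using that assms(2) by auto
    then show ?thesis
      using sum_moment_points_eqD[of \<delta> S "\<lambda>_. 0" k, where 'd = 'd] assms(4) by simp
  qed
  then obtain s where s: "\<And>i. i < 2 * r \<Longrightarrow> s i < s (Suc i)"
    "\<And>i. i < 2 * r \<Longrightarrow> \<delta> (s i) * \<delta> (s (Suc i)) < 0" "s ` {..2 * r} \<subseteq> S" "\<delta> (s 0) \<noteq> 0"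
    using vanishing_moments_imp_sign_changes[OF assms(1) _ assms(5), of "2 * r"] by blast
  have mono: "s i < s j" if "i < j" "j \<le> 2 * r" for i j
    using lift_less_upto[of "2 * r" s i j] s(1) that by blast
  define G where "G = (\<lambda>i. s (2 * i)) ` {..r}"
  have sign: "\<delta> (s (2 * i)) * \<delta> (s 0) > 0" if "i \<le> r" for i
    using that
  proof (induction i)
    case 0
    then show ?case
      using s(4) by (auto simp: zero_less_mult_iff linorder_neq_iff)
  next
    case (Suc i)
    then show ?case
      using s(2)[of "2 * i"] s(2)[of "Suc (2 * i)"]
      by (auto simp: zero_less_mult_iff mult_less_0_iff)
  qed
  have "inj_on (\<lambda>i. s (2 * i)) {..r}"
  proof (rule linorder_inj_onI)
    fix i j assume "i < j" "i \<in> {..r}" "j \<in> {..r}"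
    then show "s (2 * i) \<noteq> s (2 * j)"
      using mono[of "2 * i" "2 * j"] by auto
  qed auto
  then have "card G = Suc r"
    by (simp add: G_def card_image)
  moreover have "gapped G"
    unfolding gapped_def
  proof (intro ballI notI)
    fix g assume "g \<in> G" "Suc g \<in> G"
    then obtain i j where ij: "i \<le> r" "j \<le> r" "g = s (2 * i)" "Suc g = s (2 * j)"
      by (auto simp: G_def)
    have "i < j"
    proof (cases i j rule: linorder_cases)
      case greater
      then show ?thesis
        using mono[of "2 * j" "2 * i"] ij by auto
    qed (use ij in auto)
    then show False
      using mono[of "2 * i" "Suc (2 * i)"] mono[of "Suc (2 * i)" "2 * j"] ij by auto
  qed
  moreover have "G \<subseteq> S"
    using s(3) by (auto simp: G_def image_subset_iff)
  moreover have "G \<subseteq> {t. \<delta> t > 0} \<or> G \<subseteq> {t. \<delta> t < 0}"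
  proof (cases "\<delta> (s 0) > 0")
    case True
    then have "\<delta> (s (2 * i)) > 0" if "i \<le> r" for i
      using sign[OF that] by (simp add: zero_less_mult_iff)
    then show ?thesis
      by (auto simp: G_def)
  next
    case False
    then have "\<delta> (s (2 * i)) < 0" if "i \<le> r" for i
      using sign[OF that] by (auto simp: zero_less_mult_iff)
    then show ?thesis
      by (auto simp: G_def)
  qed
  ultimately show ?thesis
    by blast
qed

text \<open>The support of a dependence would contain \<open>r + 1\<close> pairwise non-adjacent
  elements of \<open>S\<close>.\<close>

lemma narrow_imp_affine_independent:
  assumes "finite S" "CARD('d) = 2 * r - 1" "narrow r S"
  shows "\<not> affine_dependent (moment_point ` S :: (real ^ 'd::{finite, linorder}) set)"
proof
  let ?f = "moment_point :: nat \<Rightarrow> (real, 'd) vec"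
  assume "affine_dependent (?f ` S)"
  then obtain U where U: "sum U (?f ` S) = 0" "\<exists>v\<in>?f ` S. U v \<noteq> 0" "(\<Sum>v\<in>?f ` S. U v *\<^sub>R v) = 0"
    using assms(1) affine_dependent_explicit_finite[of "?f ` S"] by auto
  have "sum (\<lambda>t. U (?f t)) S = 0" "\<exists>t\<in>S. U (?f t) \<noteq> 0" "(\<Sum>t\<in>S. U (?f t) *\<^sub>R ?f t) = 0"
    using U inj_moment_point[where 'd = 'd and X = S] by (auto simp: sum.reindex)
  then obtain G where "card G = Suc r" "gapped G" "G \<subseteq> S"
    using affine_relation_imp_large_gapped_set[OF assms(1,2), of "\<lambda>t. U (?f t)"] by blast
  then show False
    using assms(3) by (auto simp: narrow_def)
qed

text \<open>The difference \<open>u - v\<close> is an affine relation. Where it is positive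
  \<open>u\<close> is nonzero, and where it is negative \<open>v\<close> is nonzero, so one of the
  two narrow supports would contain \<open>r + 1\<close> pairwise non-adjacent elements.\<close>

lemma narrow_combination_unique:
  assumes "finite X" "CARD('d) = 2 * r - 1"
    and "\<And>t. t \<in> X \<Longrightarrow> 0 \<le> u t" "\<And>t. t \<in> X \<Longrightarrow> 0 \<le> v t"
    and "narrow r {t \<in> X. u t \<noteq> 0}" "narrow r {t \<in> X. v t \<noteq> 0}" "sum u X = sum v X"
    and "(\<Sum>t\<in>X. u t *\<^sub>R (moment_point t :: real ^ 'd::{finite, linorder})) = (\<Sum>t\<in>X. v t *\<^sub>R moment_point t)"
    and "t \<in> X"
  shows "u t = v t"
proof (rule ccontr)
  assume "u t \<noteq> v t"
  then have "\<exists>t\<in>X. u t - v t \<noteq> 0"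
    using assms(9) by auto
  moreover have "(\<Sum>t\<in>X. (u t - v t) *\<^sub>R (moment_point t :: (real, 'd) vec)) = 0"
    using assms(8) by (simp add: scaleR_left_diff_distrib sum_subtractf)
  moreover have "(\<Sum>t\<in>X. u t - v t) = 0"
    using assms(7) by (simp add: sum_subtractf)
  ultimately obtain G where G: "card G = Suc r" "gapped G"
    "G \<subseteq> {t \<in> X. u t - v t > 0} \<or> G \<subseteq> {t \<in> X. u t - v t < 0}"
    using affine_relation_imp_large_gapped_set[OF assms(1,2), of "\<lambda>t. u t - v t"] by blast
  have "G \<subseteq> {t \<in> X. u t \<noteq> 0} \<or> G \<subseteq> {t \<in> X. v t \<noteq> 0}"
    using G(3)
  proof
    assume "G \<subseteq> {t \<in> X. u t - v t > 0}"
    then show ?thesis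
      using assms(4) by force
  next
    assume "G \<subseteq> {t \<in> X. u t - v t < 0}"
    then show ?thesis
      using assms(3) by force
  qed
  then have "card G \<le> r"
    using G(2) assms(5,6) unfolding narrow_def by blast
  then show False
    using G(1) by simp
qed

section \<open>Circuits and the lower envelope of the lifted points\<close>

lemma card_greater_real_image: "card {b \<in> real ` A. real a < b} = card {b \<in> A. a < b}"
proof -
  have "{b \<in> real ` A. real a < b} = real ` {b \<in> A. a < b}"
    by auto
  then show ?thesis
    by (simp add: card_image)
qed

text \<open>
  A positive weight on \<open>r + 1\<close> pairwise non-adjacent parameters can be shifted along a circuit of
  \<open>2 * r + 1\<close> parameters in a way that lowers the height \<open>t ^ (2 * r)\<close>. Hence the lower envelope of
  the lifted points only involves narrow sets.
\<close>

lemma gapped_circuit: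
  assumes "G \<subseteq> {1..n}" "card G = Suc r" "gapped G"
  obtains c :: "nat \<Rightarrow> real" where "\<And>t. t \<notin> G \<Longrightarrow> c t \<le> 0"
    "\<And>k. k < 2 * r \<Longrightarrow> (\<Sum>t\<in>{1..n}. c t * real t ^ k) = 0"
    "(\<Sum>t\<in>{1..n}. c t * real t ^ (2 * r)) = 1"
proof -
  have fin: "finite G" and ne: "G \<noteq> {}"
    using assms finite_subset by fastforce+
  define M where "M = Max G"
  have M: "M \<in> G" "\<And>g. g \<in> G \<Longrightarrow> g \<le> M"
    using fin ne by (auto simp: M_def)
  \<comment> \<open>A separator is put right after each element of \<open>G\<close> but the largest;
    it is new because \<open>G\<close> is gapped.\<close>
  define C where "C = G \<union> Suc ` (G - {M})"
  have disj: "G \<inter> Suc ` (G - {M}) = {}"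
    using assms(3) by (auto simp: gapped_def)
  have finC: "finite C"
    using fin by (simp add: C_def)
  have "card C = card G + card (G - {M})"
    unfolding C_def using fin disj by (subst card_Un_disjoint) (auto simp: card_image)
  then have "card C = Suc (2 * r)"
    using assms(2) M(1) fin by simp
  then have cardC: "card (real ` C) = Suc (2 * r)"
    by (simp add: card_image)
  have "C \<subseteq> {1..n}"
  proof -
    have "Suc g \<in> {1..n}" if "g \<in> G" "g \<noteq> M" for g
      using M(2)[OF that(1)] that(2) M(1) assms(1) by fastforce
    then show ?thesis
      using assms(1) unfolding C_def by blast
  qed
  \<comment> \<open>The circuit is the divided difference over \<open>C\<close>. Its coefficients
    alternate, and the elements of \<open>G\<close> are the odd places of \<open>C\<close>.\<close>
  define c where "c t = (if t \<in> C then 1 / (\<Prod>b\<in>real ` C - {real t}. real t - b) else 0)" for t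
  have dd: "(\<Sum>t\<in>{1..n}. c t * real t ^ k) = divided_difference (real ` C) (\<lambda>x. x ^ k)" for k
  proof -
    have "(\<Sum>t\<in>{1..n}. c t * real t ^ k) = (\<Sum>t\<in>C. c t * real t ^ k)"
      using \<open>C \<subseteq> {1..n}\<close> by (intro sum.mono_neutral_right) (auto simp: c_def)
    also have "\<dots> = divided_difference (real ` C) (\<lambda>x. x ^ k)"
      by (simp add: divided_difference_def sum.reindex c_def)
    finally show ?thesis .
  qed
  have neg: "c t \<le> 0" if t: "t \<notin> G" for t
  proof (cases "t \<in> C")
    case True
    then obtain g where g: "t = Suc g" "g \<in> G" "g \<noteq> M"
      using t by (auto simp: C_def)
    have "g < M"
      using M(2)[OF g(2)] g(3) by simp
    have gap: "Suc g < h" if "h \<in> G" "g < h" for h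
      using that g(2) assms(3) by (metis Suc_lessI gapped_def)
    \<comment> \<open>Above \<open>t\<close> lie the elements of \<open>G\<close> beyond
      \<open>g\<close> and the separators of all of these but \<open>M\<close>: an odd
      number.\<close>
    have "{b \<in> C. t < b} = {h \<in> G. g < h} \<union> Suc ` ({h \<in> G. g < h} - {M})"
      using gap g by (auto simp: C_def)
    moreover have "{h \<in> G. g < h} \<inter> Suc ` ({h \<in> G. g < h} - {M}) = {}"
      using disj by auto
    ultimately have "card {b \<in> C. t < b} = card {h \<in> G. g < h} + card ({h \<in> G. g < h} - {M})"
      using fin by (simp add: card_Un_disjoint card_image)
    also have "card {h \<in> G. g < h} = Suc (card ({h \<in> G. g < h} - {M}))"
      using M(1) \<open>g < M\<close> fin by (intro card.remove) auto
    finally have "odd (card {b \<in> C. t < b})"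
      by simp
    then have "(\<Prod>b\<in>real ` C - {real t}. real t - b) < 0"
      using prod_diff_sign[of "real ` C" "real t"] finC by (simp add: card_greater_real_image)
    then show ?thesis
      by (simp add: c_def)
  qed (simp add: c_def)
  show ?thesis
    using that[OF neg] dd divided_difference_power_less[OF cardC] divided_difference_power_eq[OF cardC]
    by simp
qed

text \<open>Among all weights representing \<open>x\<close>, take those of least height. Their
  support is narrow, since otherwise subtracting a multiple of a circuit would lower the
  height.\<close>

lemma convex_hull_moment_points_narrow:
  fixes x :: "real ^ 'd::{finite, linorder}"
  assumes "CARD('d) = 2 * r - 1" and x: "x \<in> convex hull (moment_point ` {1..n})"
  shows "\<exists>S\<subseteq>{1..n}. narrow r S \<and> x \<in> convex hull (moment_point ` S)"
proof -
  let ?f = "moment_point :: nat \<Rightarrow> (real, 'd) vec"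
  define X where "X = {1..n}"
  have "finite X"
    by (simp add: X_def)
  define L where "L t = (?f t, real t ^ (2 * r))" for t
  have injL: "inj_on L X"
    using inj_moment_point[where 'd = 'd and X = X] by (auto simp: inj_on_def L_def)
  have L_sum: "(\<Sum>t\<in>X. u t *\<^sub>R L t) = (\<Sum>t\<in>X. u t *\<^sub>R ?f t, \<Sum>t\<in>X. u t * real t ^ (2 * r))" for u
    by (simp add: L_def sum_prod)
  have in_hull: "(\<Sum>t\<in>X. u t *\<^sub>R ?f t, \<Sum>t\<in>X. u t * real t ^ (2 * r)) \<in> convex hull (L ` X)"
    if "\<forall>t\<in>X. 0 \<le> u t" "sum u X = 1" for u
    using convex_hull_injective_image[OF \<open>finite X\<close> order_refl injL] that L_sum by auto
  \<comment> \<open>The part of the lifted polytope above \<open>x\<close>, compact, so that a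
    lowest point exists.\<close>
  define K where "K = convex hull (L ` X) \<inter> ({x} \<times> UNIV)"
  have "compact K"
    unfolding K_def using \<open>finite X\<close>
    by (intro compact_Int_closed finite_imp_compact_convex_hull closed_Times) auto
  moreover have "K \<noteq> {}"
  proof -
    obtain u where "\<forall>t\<in>X. 0 \<le> u t" "sum u X = 1" "(\<Sum>t\<in>X. u t *\<^sub>R ?f t) = x"
      using x convex_hull_injective_image[OF \<open>finite X\<close> order_refl inj_moment_point[where 'd = 'd]]
      unfolding X_def by auto
    then show ?thesis
      using in_hull[of u] by (auto simp: K_def)
  qed
  ultimately have "\<exists>z\<in>K. \<forall>y\<in>K. snd z \<le> snd y"
    by (intro continuous_attains_inf continuous_intros)
  then obtain z where z: "z \<in> K" "\<And>y. y \<in> K \<Longrightarrow> snd z \<le> snd y"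
    by blast
  obtain u where u: "\<forall>t\<in>X. 0 \<le> u t" "sum u X = 1" "(\<Sum>t\<in>X. u t *\<^sub>R L t) = z"
    using z(1) convex_hull_injective_image[OF \<open>finite X\<close> order_refl injL] by (auto simp: K_def)
  have ux: "(\<Sum>t\<in>X. u t *\<^sub>R ?f t) = x" and uh: "(\<Sum>t\<in>X. u t * real t ^ (2 * r)) = snd z"
    using u(3) z(1) unfolding L_sum by (auto simp: K_def)
  define S where "S = {t \<in> X. u t \<noteq> 0}"
  have "narrow r S"
    unfolding narrow_def
  proof (intro allI impI, rule ccontr)
    fix G' assume G': "G' \<subseteq> S" "gapped G'" "\<not> card G' \<le> r"
    then obtain G where G: "G \<subseteq> G'" "card G = Suc r"
      by (meson not_less_eq_eq obtain_subset_with_card_n)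
    have "gapped G"
      using G' G gapped_subset by blast
    have "G \<subseteq> S"
      using G G' by auto
    then have "G \<subseteq> {1..n}"
      by (auto simp: S_def X_def)
    have "finite G"
      using \<open>G \<subseteq> {1..n}\<close> finite_subset by blast
    from gapped_circuit[OF \<open>G \<subseteq> {1..n}\<close> G(2) \<open>gapped G\<close>] obtain c :: "nat \<Rightarrow> real"
      where c: "\<And>t. t \<notin> G \<Longrightarrow> c t \<le> 0" "\<And>k. k < 2 * r \<Longrightarrow> (\<Sum>t\<in>X. c t * real t ^ k) = 0"
        "(\<Sum>t\<in>X. c t * real t ^ (2 * r)) = 1"
      unfolding X_def by blast
    \<comment> \<open>Small enough to keep \<open>u - \<epsilon> * c\<close> nonnegative on
      \<open>G\<close>; off \<open>G\<close> it can only grow. The summand 1 keeps the denominators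
      positive.\<close>
    define \<epsilon> where "\<epsilon> = Min ((\<lambda>t. u t / (1 + \<bar>c t\<bar>)) ` G)"
    have "G \<noteq> {}"
      using G by auto
    have upos: "u t > 0" if "t \<in> G" for t
      using that \<open>G \<subseteq> S\<close> u(1) by (force simp: S_def)
    have \<epsilon>: "\<epsilon> > 0"
      unfolding \<epsilon>_def using \<open>finite G\<close> \<open>G \<noteq> {}\<close> upos by (subst Min_gr_iff) (auto intro!: divide_pos_pos)
    have \<epsilon>_le: "\<epsilon> * c t \<le> u t" if "t \<in> G" for t
    proof -
      have "\<epsilon> \<le> u t / (1 + \<bar>c t\<bar>)"
        unfolding \<epsilon>_def using \<open>finite G\<close> that by (intro Min_le) auto
      then have "\<epsilon> * (1 + \<bar>c t\<bar>) \<le> u t"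
        by (subst (asm) pos_le_divide_eq) auto
      moreover have "\<epsilon> * c t \<le> \<epsilon> * (1 + \<bar>c t\<bar>)"
        using \<epsilon> by (intro mult_left_mono) auto
      ultimately show ?thesis by simp
    qed
    define v where "v t = u t - \<epsilon> * c t" for t
    have v_nonneg: "0 \<le> v t" if "t \<in> X" for t
    proof (cases "t \<in> G")
      case False
      then have "\<epsilon> * c t \<le> 0"
        using c(1) \<epsilon> by (simp add: mult_le_0_iff)
      then show ?thesis
        using u(1) that by (force simp: v_def)
    qed (use \<epsilon>_le in \<open>simp add: v_def\<close>)
    have "r \<ge> 1"
      using assms(1) zero_less_card_finite[where 'a = 'd] by (cases r) auto
    have v_sum: "sum v X = 1"
      using u(2) c(2)[of 0] \<open>r \<ge> 1\<close> by (simp add: v_def sum_subtractf flip: sum_distrib_left)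
    have "(\<Sum>t\<in>X. c t *\<^sub>R ?f t) = 0"
      using c(2) assms(1) by (intro sum_moment_points_eq_0) auto
    then have "(\<Sum>t\<in>X. (\<epsilon> * c t) *\<^sub>R ?f t) = 0"
      by (simp flip: scaleR_scaleR scaleR_sum_right)
    then have v_x: "(\<Sum>t\<in>X. v t *\<^sub>R ?f t) = x"
      using ux by (simp add: v_def scaleR_left_diff_distrib sum_subtractf)
    have "(\<Sum>t\<in>X. v t * real t ^ (2 * r)) = snd z - \<epsilon> * (\<Sum>t\<in>X. c t * real t ^ (2 * r))"
      by (simp add: v_def left_diff_distrib sum_subtractf uh sum_distrib_left mult.assoc)
    then have "(x, snd z - \<epsilon>) \<in> K"
      using in_hull[of v] v_nonneg v_sum v_x c(3) by (simp add: K_def)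
    then show False
      using z(2)[of "(x, snd z - \<epsilon>)"] \<epsilon> by simp
  qed
  moreover have "x \<in> convex hull (?f ` S)"
    using convex_hull_injective_image[OF \<open>finite X\<close> _ inj_moment_point[where 'd = 'd], of S x] u ux
    by (auto simp: S_def)
  moreover have "S \<subseteq> {1..n}"
    by (auto simp: S_def X_def)
  ultimately show ?thesis
    by blast
qed

section \<open>The triangulation and the blocking set\<close>

text \<open>All weights at parameters other than \<open>t\<close> vanish, so a representation
  avoiding \<open>t\<close> would have total weight 0.\<close>

lemma moment_point_in_convex_hull:
  assumes "CARD('d) \<ge> 2" "finite S"
    and "moment_point t \<in> convex hull (moment_point ` S :: (real ^ 'd::{finite, linorder}) set)"
  shows "t \<in> S"
proof (rule ccontr)
  assume "t \<notin> S"
  from assms(3) obtain u where u: "\<forall>s\<in>S. 0 \<le> u s" "sum u S = 1"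
    "(\<Sum>s\<in>S. u s *\<^sub>R moment_point s) = (moment_point t :: (real, 'd) vec)"
    using convex_hull_injective_image[OF assms(2) order_refl inj_moment_point[where 'd = 'd]] by blast
  have "u s = 0" if s: "s \<in> S" for s
    by (rule moment_point_combination[OF assms(2) _ u(2,3) assms(1) s]) (use u(1) s \<open>t \<notin> S\<close> in auto)
  then show False
    using u(2) by simp
qed

text \<open>By uniqueness a common point has a single weight function, and this vanishes outside
  both \<open>S\<close> and \<open>S'\<close>.\<close>

lemma convex_hull_narrow_Int:
  fixes f :: "nat \<Rightarrow> real ^ 'd::{finite, linorder}"
  assumes "finite X" "S \<subseteq> X" "S' \<subseteq> X" "narrow r S" "narrow r S'" "CARD('d) = 2 * r - 1"
  defines "f \<equiv> moment_point"
  shows "convex hull (f ` S) \<inter> convex hull (f ` S') = convex hull (f ` (S \<inter> S'))"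
proof
  show "convex hull (f ` (S \<inter> S')) \<subseteq> convex hull (f ` S) \<inter> convex hull (f ` S')"
    by (simp add: hull_mono image_mono)
  show "convex hull (f ` S) \<inter> convex hull (f ` S') \<subseteq> convex hull (f ` (S \<inter> S'))"
  proof
    fix x assume x: "x \<in> convex hull (f ` S) \<inter> convex hull (f ` S')"
    have inj: "inj_on f X"
      unfolding f_def by (rule inj_moment_point)
    obtain u where u: "\<forall>t\<in>X. 0 \<le> u t" "\<forall>t\<in>X - S. u t = 0" "sum u X = 1" "(\<Sum>t\<in>X. u t *\<^sub>R f t) = x"
      using x convex_hull_injective_image[OF assms(1,2) inj] by blast
    obtain v where v: "\<forall>t\<in>X. 0 \<le> v t" "\<forall>t\<in>X - S'. v t = 0" "sum v X = 1" "(\<Sum>t\<in>X. v t *\<^sub>R f t) = x"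
      using x convex_hull_injective_image[OF assms(1,3) inj] by blast
    have nu: "narrow r {t \<in> X. u t \<noteq> 0}"
      by (rule narrow_subset[OF assms(4)]) (use u(2) in auto)
    have nv: "narrow r {t \<in> X. v t \<noteq> 0}"
      by (rule narrow_subset[OF assms(5)]) (use v(2) in auto)
    have "sum u X = sum v X" "(\<Sum>t\<in>X. u t *\<^sub>R moment_point t) = (\<Sum>t\<in>X. v t *\<^sub>R (moment_point t :: (real, 'd) vec))"
      using u(3,4) v(3,4) by (simp_all add: f_def)
    from narrow_combination_unique[OF assms(1,6) _ _ nu nv this]
    have "u t = v t" if "t \<in> X" for t
      using u(1) v(1) that by blast
    then have "\<forall>t\<in>X - S \<inter> S'. u t = 0"
      using u(2) v(2) by auto
    then show "x \<in> convex hull (f ` (S \<inter> S'))"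
      using convex_hull_injective_image[OF assms(1) _ inj, of "S \<inter> S'" x] assms(2) u by blast
  qed
qed

text \<open>The choice \<open>S = {}\<close> contributes the empty face, as closure under faces
  demands.\<close>

definition narrow_complex :: "nat \<Rightarrow> nat \<Rightarrow> (real ^ 'd::{finite, linorder}) set set" where
  "narrow_complex r n = (\<lambda>S. convex hull (moment_point ` S)) ` {S. S \<subseteq> {1..n} \<and> narrow r S}"

text \<open>Affine independence makes the members simplices, closure under subsets provides their
  faces, unique representation makes them meet in common faces, and the lower envelope argument
  covers the hull.\<close>

lemma triangulates_narrow_complex:
  assumes "r \<ge> 1" "CARD('d) = 2 * r - 1"
  shows "triangulates (narrow_complex r n) (moment_point ` {1..n} :: (real ^ 'd::{finite, linorder}) set)"
proof -
  let ?f = "moment_point :: nat \<Rightarrow> (real, 'd) vec"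
  let ?T = "narrow_complex r n :: (real, 'd) vec set set"
  have indep: "\<not> affine_dependent (?f ` S)" if "S \<subseteq> {1..n}" "narrow r S" for S
    using that finite_subset narrow_imp_affine_independent[OF _ assms(2)] by blast
  have "finite {S. S \<subseteq> {1..n} \<and> narrow r S}"
    by (rule finite_subset[of _ "Pow {1..n}"]) auto
  then have "finite ?T"
    by (simp add: narrow_complex_def)
  moreover have "\<exists>k. k simplex F" if F: "F \<in> ?T" for F
  proof -
    obtain S where S: "S \<subseteq> {1..n}" "narrow r S" "F = convex hull (?f ` S)"
      using F by (auto simp: narrow_complex_def)
    have "(int (card (?f ` S)) - 1) simplex F"
      unfolding S(3) by (rule simplex_convex_hull) (use indep S in auto)
    then show ?thesis ..
  qed
  moreover have "F' \<in> ?T" if F: "F \<in> ?T" "F' face_of F" for F F'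
  proof -
    obtain S where S: "S \<subseteq> {1..n}" "narrow r S" "F = convex hull (?f ` S)"
      using F by (auto simp: narrow_complex_def)
    then obtain c where c: "c \<subseteq> ?f ` S" "F' = convex hull c"
      using F(2) face_of_convex_hull_affine_independent[OF indep[OF S(1,2)]] by blast
    then obtain S' where "S' \<subseteq> S" "c = ?f ` S'"
      by (meson subset_image_iff)
    moreover from this have "narrow r S'" "S' \<subseteq> {1..n}"
      using S narrow_subset by blast+
    ultimately show ?thesis
      using c by (auto simp: narrow_complex_def)
  qed
  moreover have "(F \<inter> F') face_of F" if F: "F \<in> ?T" "F' \<in> ?T" for F F'
  proof -
    obtain S S' where S: "S \<subseteq> {1..n}" "narrow r S" "F = convex hull (?f ` S)"
      "S' \<subseteq> {1..n}" "narrow r S'" "F' = convex hull (?f ` S')"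
      using F unfolding narrow_complex_def by blast
    then have "F \<inter> F' = convex hull (?f ` (S \<inter> S'))"
      using convex_hull_narrow_Int[of "{1..n}" S S' r, where 'd = 'd] assms(2) by simp
    then have "(F \<inter> F') face_of convex hull (?f ` S)"
      unfolding face_of_convex_hull_affine_independent[OF indep[OF S(1,2)]]
      by (intro exI[of _ "?f ` (S \<inter> S')"]) auto
    then show ?thesis
      by (simp only: S(3))
  qed
  ultimately have "simplicial_complex ?T"
    unfolding simplicial_complex_def by blast
  moreover have "{v. {v} \<in> ?T} = ?f ` {1..n}"
  proof
    show "{v. {v} \<in> ?T} \<subseteq> ?f ` {1..n}"
    proof clarify
      fix v assume "{v} \<in> ?T"
      then obtain S where S: "S \<subseteq> {1..n}" "{v} = convex hull (?f ` S)"
        by (auto simp: narrow_complex_def)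
      then have "S \<noteq> {}"
        by auto
      then obtain t where "t \<in> S"
        by blast
      then have "?f t \<in> {v}"
        unfolding S(2) by (simp add: hull_inc)
      then show "v \<in> ?f ` {1..n}"
        using S(1) \<open>t \<in> S\<close> by auto
    qed
    show "?f ` {1..n} \<subseteq> {v. {v} \<in> ?T}"
    proof clarify
      fix t assume t: "t \<in> {1..n}"
      have "narrow r {t}"
        unfolding narrow_def
      proof (intro allI impI)
        fix G assume "G \<subseteq> {t}"
        then have "card G \<le> card {t}"
          by (intro card_mono) auto
        then show "card G \<le> r"
          using assms(1) by simp
      qed
      moreover have "{?f t} = convex hull (?f ` {t})"
        by simp
      ultimately show "{?f t} \<in> ?T"
        unfolding narrow_complex_def using t by blast
    qed
  qed
  moreover have "\<Union>?T = convex hull (?f ` {1..n})"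
  proof
    show "\<Union>?T \<subseteq> convex hull (?f ` {1..n})"
      unfolding narrow_complex_def using hull_mono[of "?f ` _" "?f ` {1..n}" convex] by blast
    show "convex hull (?f ` {1..n}) \<subseteq> \<Union>?T"
      unfolding narrow_complex_def using convex_hull_moment_points_narrow[OF assms(2)] by blast
  qed
  ultimately show ?thesis
    by (simp add: triangulates_def)
qed

text \<open>Points of the curve are in convex position, so the hull of a narrow set determines its
  parameters.\<close>

lemma face_count_narrow_complex_ge:
  assumes "r \<ge> 2" "CARD('d) = 2 * r - 1"
  shows "card {A. A \<subseteq> {1..n} \<and> card A = 2 * r - 1 \<and> narrow r A} \<le>
    face_count (int CARD('d) - 1) (narrow_complex r n :: (real ^ 'd::{finite, linorder}) set set)"
proof -
  let ?f = "moment_point :: nat \<Rightarrow> (real, 'd) vec"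
  let ?T = "narrow_complex r n :: (real, 'd) vec set set"
  let ?As = "{A. A \<subseteq> {1..n} \<and> card A = 2 * r - 1 \<and> narrow r A}"
  have fin: "finite A" if "A \<in> ?As" for A
    using that finite_subset by blast
  have card2: "CARD('d) \<ge> 2"
    using assms by simp
  have sub: "A \<subseteq> A'" if A: "A \<in> ?As" "A' \<in> ?As" "convex hull (?f ` A) = convex hull (?f ` A')" for A A'
  proof
    fix t assume "t \<in> A"
    then have "?f t \<in> convex hull (?f ` A')"
      unfolding A(3)[symmetric] by (simp add: hull_inc)
    then show "t \<in> A'"
      using moment_point_in_convex_hull[OF card2 fin[OF A(2)]] by blast
  qed
  have "inj_on (\<lambda>A. convex hull (?f ` A)) ?As"
  proof (rule inj_onI)
    fix A A' assume h: "A \<in> ?As" "A' \<in> ?As" "convex hull (?f ` A) = convex hull (?f ` A')"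
    show "A = A'"
      using sub[OF h] sub[OF h(2,1) h(3)[symmetric]] by (rule subset_antisym)
  qed
  then have "card ?As = card ((\<lambda>A. convex hull (?f ` A)) ` ?As)"
    by (simp only: card_image)
  also have "\<dots> \<le> card {F \<in> ?T. (int CARD('d) - 1) simplex F}"
  proof (rule card_mono)
    have "finite {S. S \<subseteq> {1..n} \<and> narrow r S}"
      by (rule finite_subset[of _ "Pow {1..n}"]) auto
    then show "finite {F \<in> ?T. (int CARD('d) - 1) simplex F}"
      by (simp add: narrow_complex_def)
    show "(\<lambda>A. convex hull (?f ` A)) ` ?As \<subseteq> {F \<in> ?T. (int CARD('d) - 1) simplex F}"
    proof (rule image_subsetI)
      fix A assume A: "A \<in> ?As"
      have "\<not> affine_dependent (?f ` A)"
        using narrow_imp_affine_independent[OF fin[OF A] assms(2)] A by simp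
      moreover have "int (card (?f ` A)) = int CARD('d) - 1 + 1"
        using A assms(2) card_image[OF inj_moment_point[where 'd = 'd and X = A]] by simp
      ultimately have "(int CARD('d) - 1) simplex (convex hull (?f ` A))"
        by (intro simplex_convex_hull conjI)
      then show "convex hull (?f ` A) \<in> {F \<in> ?T. (int CARD('d) - 1) simplex F}"
        using A by (auto simp: narrow_complex_def)
    qed
  qed
  finally show ?thesis
    by (simp add: face_count_def)
qed

text \<open>Choose a blocking point in the relative interior of each codimension-one face. If two
  faces share their point, their intersection is a face of each that meets the relative interior,
  hence all of each.\<close>

lemma face_count_le_card_blocking_set:
  fixes P :: "'a::euclidean_space set"
  assumes "triangulates T P" "blocks Q P" "finite Q"
  shows "face_count (int DIM('a) - 1) T \<le> card Q"
proof -
  let ?Fs = "{F \<in> T. (int DIM('a) - 1) simplex F}"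
  have T: "simplicial_complex T" "{v. {v} \<in> T} = P"
    using assms(1) by (auto simp: triangulates_def)
  have "Q \<inter> rel_interior F \<noteq> {}" if F: "F \<in> ?Fs" for F
  proof -
    obtain C where C: "\<not> affine_dependent C" "int (card C) = int DIM('a)" "F = convex hull C"
      using F by (auto simp: simplex_def)
    \<comment> \<open>A vertex of \<open>F\<close> is a singleton face of \<open>F\<close>, hence a
      member of \<open>T\<close>, hence a point of \<open>P\<close>.\<close>
    have "C \<subseteq> P"
    proof
      fix v assume "v \<in> C"
      then have "{v} face_of F"
        unfolding C(3) face_of_convex_hull_affine_independent[OF C(1)] by (intro exI[of _ "{v}"]) auto
      then have "{v} \<in> T"
        using T(1) F unfolding simplicial_complex_def by blast
      then show "v \<in> P"
        using T(2) by blast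
    qed
    then show ?thesis
      using assms(2) C(2,3) by (simp add: blocks_def)
  qed
  then have "\<forall>F\<in>?Fs. \<exists>q. q \<in> Q \<inter> rel_interior F"
    by blast
  then obtain q where q: "\<And>F. F \<in> ?Fs \<Longrightarrow> q F \<in> Q \<inter> rel_interior F"
    by metis
  have sub: "F \<subseteq> F'" if F: "F \<in> ?Fs" "F' \<in> ?Fs" "q F = q F'" for F F'
  proof -
    have face: "(F \<inter> F') face_of F"
      using T(1) F unfolding simplicial_complex_def by blast
    have "q F \<in> (F \<inter> F') \<inter> rel_interior F"
      using q[OF F(1)] q[OF F(2)] F(3) rel_interior_subset by fastforce
    then have "F \<subseteq> F \<inter> F'"
      using subset_of_face_of[OF face order_refl] by blast
    then show ?thesis
      by blast
  qed
  have "inj_on q ?Fs"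
  proof (rule inj_onI)
    fix F F' assume h: "F \<in> ?Fs" "F' \<in> ?Fs" "q F = q F'"
    show "F = F'"
      using sub[OF h] sub[OF h(2,1) h(3)[symmetric]] by (rule subset_antisym)
  qed
  moreover have "q ` ?Fs \<subseteq> Q"
    using q by blast
  ultimately show ?thesis
    unfolding face_count_def using assms(3) by (rule card_inj_on_le)
qed

text \<open>
  The barycentre of the moment points with parameters in \<open>B\<close>, moved in the last two coordinates.
  The divided difference over a set \<open>A\<close> of \<open>2 * r - 1\<close> parameters kills the powers below
  \<open>2 * r - 2\<close> and has the values \<open>1\<close> and \<open>\<Sum>A\<close> on the next two, which is where the direction comes from.
\<close>

definition blocking_point :: "nat \<Rightarrow> nat set \<Rightarrow> real \<Rightarrow> real ^ 'd::{finite, linorder}" where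
  "blocking_point r B \<sigma> = (1 / (real r - 1)) *\<^sub>R (\<Sum>b\<in>B. moment_point b) +
     (1 / real r) *\<^sub>R (\<chi> i. if card {j. j \<le> i} = 2 * r - 2 then 1
                          else if card {j. j \<le> i} = 2 * r - 1 then \<sigma> else 0)"

text \<open>The weights are \<open>1 / r\<close> times the divided difference coefficients over
  \<open>A\<close> plus the barycentric weights \<open>1 / (r - 1)\<close> on the even places. The
  former sum to 0 and the latter to 1.\<close>

lemma blocking_point_combination:
  assumes "r \<ge> 2" "CARD('d) = 2 * r - 1" "A \<subseteq> {1..n}" "card A = 2 * r - 1"
  obtains c :: "nat \<Rightarrow> real" where "\<And>a. a \<in> A \<Longrightarrow> 0 < c a" "sum c A = 1"
    "(\<Sum>a\<in>A. c a *\<^sub>R moment_point a) =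
      (blocking_point r (even_places A) (real (\<Sum>A)) :: real ^ 'd::{finite, linorder})"
proof -
  have fin: "finite A"
    using assms(3) finite_subset by blast
  have cardA: "card A = Suc (2 * (r - 1))"
    using assms by simp
  define B where "B = even_places A"
  have B: "B \<subseteq> A" "card B = r - 1"
    using even_places_sum_bounds(2)[OF assms(3) cardA] by (auto simp: B_def even_places_def)
  define W where "W a = (\<Prod>b\<in>real ` A - {real a}. real a - b)" for a
  define c where "c a = 1 / (real r * W a) + (if a \<in> B then 1 / (real r - 1) else 0)" for a
  have card_split: "card {b \<in> A. b < a} + card {b \<in> A. a < b} = 2 * (r - 1)" if a: "a \<in> A" for a
  proof -
    have "card (A - {a}) = card {b \<in> A. b < a} + card {b \<in> A. a < b}"
      using fin by (subst card_Un_disjoint[symmetric]) (auto intro!: arg_cong[of _ _ card])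
    then show ?thesis
      using a fin cardA by simp
  qed
  \<comment> \<open>The other elements number \<open>2 * (r - 1)\<close>, so the counts below and
    above \<open>a\<close> have equal parity: the coefficient is negative exactly at the even
    places.\<close>
  have parity: "even (card {b \<in> A. a < b}) \<longleftrightarrow> even (card {b \<in> A. b < a})" if a: "a \<in> A" for a
  proof -
    have "even (card {b \<in> A. b < a} + card {b \<in> A. a < b})"
      unfolding card_split[OF a] by simp
    then show ?thesis
      by auto
  qed
  have sign: "0 < (- 1) ^ card {b \<in> A. a < b} * W a" for a
    using prod_diff_sign[of "real ` A" "real a"] fin by (simp add: W_def card_greater_real_image)
  \<comment> \<open>Distinct integers differ by at least 1. So a negative term is at least
    \<open>- 1 / r\<close>, and \<open>1 / (r - 1)\<close> outweighs it; this is the reason for the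
    factor \<open>1 / r\<close>.\<close>
  have W_abs: "1 \<le> \<bar>W a\<bar>" for a
  proof -
    have "\<bar>W a\<bar> = (\<Prod>b\<in>real ` A - {real a}. \<bar>real a - b\<bar>)"
      by (simp add: W_def abs_prod)
    also have "\<dots> \<ge> 1"
    proof (rule prod_ge_1)
      fix x assume "x \<in> real ` A - {real a}"
      then obtain b where "x = real b" "b \<noteq> a"
        by auto
      then show "1 \<le> \<bar>real a - x\<bar>"
        by (cases a b rule: linorder_cases) auto
    qed
    finally show ?thesis .
  qed
  have pos: "0 < c a" if a: "a \<in> A" for a
  proof (cases "a \<in> B")
    case False
    then have "even (card {b \<in> A. b < a})"
      using a by (simp add: B_def even_places_def)
    then have "even (card {b \<in> A. a < b})"
      using parity[OF a] by simp
    then have "W a > 0"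
      using sign[of a] by simp
    then show ?thesis
      using False assms(1) by (simp add: c_def)
  next
    case True
    then have "odd (card {b \<in> A. b < a})"
      by (simp add: B_def even_places_def)
    then have "odd (card {b \<in> A. a < b})"
      using parity[OF a] by simp
    then have "W a < 0"
      using sign[of a] by simp
    then have "W a \<le> - 1"
      using W_abs[of a] by simp
    then have "- 1 \<le> 1 / W a"
      by (simp add: divide_simps)
    then have "- 1 / real r \<le> 1 / W a / real r"
      by (intro divide_right_mono) auto
    moreover have "1 / real r < 1 / (real r - 1)"
      using assms(1) by (intro divide_strict_left_mono) auto
    ultimately show ?thesis
      using True by (simp add: c_def mult.commute)
  qed
  have pow: "(\<Sum>a\<in>A. c a * real a ^ k) =
      (1 / real r) * divided_difference (real ` A) (\<lambda>x. x ^ k) + (1 / (real r - 1)) * (\<Sum>b\<in>B. real b ^ k)" for k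
  proof -
    have "(\<Sum>a\<in>A. c a * real a ^ k) =
        (\<Sum>a\<in>A. (1 / real r) * (real a ^ k / W a)) + (\<Sum>a\<in>A. if a \<in> B then real a ^ k / (real r - 1) else 0)"
      unfolding sum.distrib[symmetric] by (intro sum.cong) (auto simp: c_def distrib_right)
    also have "(\<Sum>a\<in>A. if a \<in> B then real a ^ k / (real r - 1) else 0) = (\<Sum>a\<in>B. real a ^ k / (real r - 1))"
      using fin B(1) by (simp add: sum.If_cases Int_absorb1)
    also have "(\<Sum>a\<in>A. (1 / real r) * (real a ^ k / W a)) = (1 / real r) * divided_difference (real ` A) (\<lambda>x. x ^ k)"
      by (simp add: divided_difference_def sum.reindex W_def sum_distrib_left)
    finally show ?thesis
      by (simp add: sum_divide_distrib)
  qed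
  have cardA': "card (real ` A) = Suc (2 * (r - 1))"
    using cardA by (simp add: card_image)
  have "sum c A = 1"
    using pow[of 0] divided_difference_power_less[OF cardA', of 0] B(2) assms(1) by (simp add: of_nat_diff)
  moreover have "(\<Sum>a\<in>A. c a *\<^sub>R moment_point a) =
      (blocking_point r (even_places A) (real (\<Sum>A)) :: (real, 'd) vec)"
  proof (subst vec_eq_iff, rule allI)
    fix i :: 'd
    define k where "k = card {j. j \<le> i}"
    have "k \<in> {1..CARD('d)}"
      unfolding k_def using bij_betw_coordinate_position[where 'd = 'd] by (auto simp: bij_betw_def)
    then consider "k < 2 * (r - 1)" | "k = 2 * (r - 1)" | "k = Suc (2 * (r - 1))"
      using assms(1,2) by force
    then have "divided_difference (real ` A) (\<lambda>x. x ^ k) =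
        (if k = 2 * r - 2 then 1 else if k = 2 * r - 1 then real (\<Sum>A) else 0)"
    proof cases
      case 1
      then show ?thesis
        using divided_difference_power_less[OF cardA' 1] by auto
    next
      case 2
      then show ?thesis
        using divided_difference_power_eq[OF cardA'] by (simp add: right_diff_distrib')
    next
      case 3
      have "divided_difference (real ` A) (\<lambda>x. x ^ k) = real (\<Sum>A)"
        unfolding 3 divided_difference_power_Suc[OF cardA'] by (simp add: sum.reindex)
      moreover have "k = 2 * r - 1" "k \<noteq> 2 * r - 2"
        using 3 assms(1) by auto
      ultimately show ?thesis
        by simp
    qed
    moreover have "(\<Sum>a\<in>A. c a *\<^sub>R (moment_point a :: (real, 'd) vec)) $ i = (\<Sum>a\<in>A. c a * real a ^ k)"
      by (simp only: sum_moment_point_nth k_def)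
    moreover have "(blocking_point r (even_places A) (real (\<Sum>A)) :: (real, 'd) vec) $ i =
      (1 / (real r - 1)) * (\<Sum>b\<in>B. real b ^ k) +
      (1 / real r) * (if k = 2 * r - 2 then 1 else if k = 2 * r - 1 then real (\<Sum>A) else 0)"
      by (simp add: blocking_point_def k_def B_def moment_curve_def)
    ultimately show "(\<Sum>a\<in>A. c a *\<^sub>R (moment_point a :: (real, 'd) vec)) $ i =
        (blocking_point r (even_places A) (real (\<Sum>A)) :: (real, 'd) vec) $ i"
      unfolding pow by simp
  qed
  ultimately show ?thesis
    using that pos by blast
qed

text \<open>One point is taken for each \<open>A\<close>, but it depends only on the label of
  \<open>A\<close>, so there are at most as many points as labels.\<close>

lemma exists_blocking_set:
  assumes "r \<ge> 2" "n \<ge> 2 * r" "CARD('d) = 2 * r - 1"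
  shows "\<exists>Q. finite Q \<and> card Q \<le> (n - 2 * r + 2) * ((n - r) choose (r - 1)) \<and>
    blocks Q (moment_point ` {1..n} :: (real ^ 'd::{finite, linorder}) set)"
proof -
  let ?f = "moment_point :: nat \<Rightarrow> (real, 'd) vec"
  define As where "As = {A. A \<subseteq> {1..n} \<and> card A = 2 * r - 1}"
  define code where "code = (\<lambda>A. (even_places A, \<Sum>A)) ` As"
  define q :: "nat set \<Rightarrow> (real, 'd) vec" where "q A = blocking_point r (even_places A) (real (\<Sum>A))" for A
  have "finite As"
    unfolding As_def by (rule finite_subset[of _ "Pow {1..n}"]) auto
  have "q ` As = (\<lambda>(B, \<sigma>). blocking_point r B (real \<sigma>)) ` code"
    by (simp add: code_def q_def image_image)
  then have "card (q ` As) \<le> card code"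
    using \<open>finite As\<close> by (simp add: code_def card_image_le)
  also have "\<dots> \<le> (n - 2 * r + 2) * ((n - r) choose (r - 1))"
    unfolding code_def As_def using assms by (intro card_even_places_sum_le) auto
  finally have card: "card (q ` As) \<le> (n - 2 * r + 2) * ((n - r) choose (r - 1))" .
  have comb: "\<exists>c. (\<forall>a\<in>A. 0 < c a) \<and> sum c A = 1 \<and> (\<Sum>a\<in>A. c a *\<^sub>R ?f a) = q A" if A: "A \<in> As" for A
  proof -
    have "A \<subseteq> {1..n}" "card A = 2 * r - 1"
      using A by (auto simp: As_def)
    from blocking_point_combination[OF assms(1,3) this]
    obtain c where "\<And>a. a \<in> A \<Longrightarrow> 0 < c a" "sum c A = 1" "(\<Sum>a\<in>A. c a *\<^sub>R ?f a) = q A"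
      unfolding q_def by blast
    then show ?thesis
      by (intro exI[of _ c]) simp
  qed
  have fin: "finite A" if "A \<in> As" for A
    using that finite_subset by (auto simp: As_def)
  have "q ` As \<inter> ?f ` {1..n} = {}"
  proof (rule ccontr)
    assume "\<not> ?thesis"
    then obtain A t where A: "A \<in> As" "q A = ?f t"
      by auto
    obtain c where c: "\<forall>a\<in>A. 0 < c a" "sum c A = 1" "(\<Sum>a\<in>A. c a *\<^sub>R ?f a) = ?f t"
      using comb[OF A(1)] A(2) by auto
    \<comment> \<open>The set \<open>A\<close> has at least three elements, so some positive weight
      sits away from \<open>t\<close>, whereas a representation of \<open>?f t\<close> has weight 0
      there.\<close>
    have "\<not> A \<subseteq> {t}"
      using card_mono[of "{t}" A] A(1) assms(1) by (auto simp: As_def)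
    then obtain a where "a \<in> A" "a \<noteq> t"
      by blast
    then have "c a = 0"
      using moment_point_combination[OF fin[OF A(1)] _ c(2,3)] c(1) assms(1,3) by (simp add: less_imp_le)
    then show False
      using c(1) \<open>a \<in> A\<close> by fastforce
  qed
  moreover have "q ` As \<inter> rel_interior (convex hull C) \<noteq> {}"
    if C: "C \<subseteq> ?f ` {1..n}" "card C = DIM((real, 'd) vec)" for C
  proof -
    obtain A where A: "A \<subseteq> {1..n}" "C = ?f ` A"
      using C(1) by (meson subset_image_iff)
    then have "A \<in> As"
      using C(2) assms(3) card_image[OF inj_moment_point[where 'd = 'd and X = A]] by (simp add: As_def)
    then obtain c where "\<forall>a\<in>A. 0 < c a" "sum c A = 1" "(\<Sum>a\<in>A. c a *\<^sub>R ?f a) = q A"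
      using comb by blast
    then have "q A \<in> rel_interior (convex hull C)"
      using positive_combination_in_rel_interior[OF fin[OF \<open>A \<in> As\<close>] inj_moment_point[where 'd = 'd], of c] A(2)
      by simp
    then show ?thesis
      using \<open>A \<in> As\<close> by blast
  qed
  ultimately have "blocks (q ` As) (?f ` {1..n})"
    unfolding blocks_def by blast
  then show ?thesis
    using card \<open>finite As\<close> by (intro exI[of _ "q ` As"] conjI) simp_all
qed

theorem theorem3:
  fixes r n :: nat
    and P :: "(real ^ 'd::{finite, linorder}) set"
  assumes "r \<ge> 2" and "n \<ge> 2 * r"
    and "CARD('d) = 2 * r - 1"
    and "P = (\<lambda>i. moment_curve (real i)) ` {1..n}"
  shows "blocking_number P = (n - 2 * r + 2) * ((n - r) choose (r - 1)) \<and>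
         (n - 2 * r + 2) * ((n - r) choose (r - 1)) = max_codim1_faces P"
proof -
  define N where "N = (n - 2 * r + 2) * ((n - r) choose (r - 1))"
  define T :: "(real, 'd) vec set set" where "T = narrow_complex r n"
  let ?F = "\<lambda>T :: (real, 'd) vec set set. face_count (int DIM((real, 'd) vec) - 1) T"
  have T: "triangulates T P"
    using triangulates_narrow_complex[of r n, where 'd = 'd] assms by (simp add: T_def)
  have "N \<le> card {A. A \<subseteq> {1..n} \<and> card A = 2 * r - 1 \<and> narrow r A}"
    unfolding N_def using assms by (intro card_narrow_sets_ge) auto
  also have "\<dots> \<le> ?F T"
    using face_count_narrow_complex_ge[OF assms(1,3), of n] by (simp add: T_def)
  finally have N_le: "N \<le> ?F T" .
  obtain Q where Q: "finite Q" "card Q \<le> N" "blocks Q P"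
    using exists_blocking_set[OF assms(1,2,3)] assms(4) unfolding N_def by blast
  have le: "?F T' \<le> card Q'" if "triangulates T' P" "finite Q'" "blocks Q' P" for T' Q'
    using face_count_le_card_blocking_set that by blast
  \<comment> \<open>The chain \<open>N \<le> ?F T \<le> card Q \<le> N\<close> closes up, so
    \<open>T\<close> and \<open>Q\<close> are both optimal.\<close>
  have "card Q = N" "?F T = N"
    using le[OF T Q(1,3)] Q(2) N_le by auto
  have "blocking_number P = N"
    unfolding blocking_number_def
  proof (rule Least_equality)
    show "\<exists>Q. finite Q \<and> card Q = N \<and> blocks Q P"
      using Q \<open>card Q = N\<close> by blast
    show "N \<le> k" if "\<exists>Q. finite Q \<and> card Q = k \<and> blocks Q P" for k
      using that le[OF T] \<open>?F T = N\<close> by auto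
  qed
  moreover have "max_codim1_faces P = N"
    unfolding max_codim1_faces_def
  proof (rule Max_eqI)
    have bound: "k \<le> N" if k: "k \<in> {?F T |T. triangulates T P}" for k
    proof -
      obtain T' where "k = ?F T'" "triangulates T' P"
        using k by blast
      then show ?thesis
        using le[of T' Q] Q(1,3) \<open>card Q = N\<close> by simp
    qed
    \<comment> \<open>The bound on the values also gives the finiteness under which
      \<open>Max\<close> is meaningful.\<close>
    have "{?F T |T. triangulates T P} \<subseteq> {..N}"
      by (rule subsetI, unfold atMost_iff, rule bound)
    then show "finite {?F T |T. triangulates T P}"
      by (rule finite_subset) simp
    show "N \<in> {?F T |T. triangulates T P}"
      by (intro CollectI exI[of _ T] conjI) (simp_all only: T \<open>?F T = N\<close>)
    show "\<And>k. k \<in> {?F T |T. triangulates T P} \<Longrightarrow> k \<le> N"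
      by (rule bound)
  qed
  ultimately show ?thesis
    unfolding N_def by simp
qed

end
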